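(* Let $(\mathbb{R}^n,g)$ be a pseudo-Euclidean space, $n\ge3$, with coordinates $x=(x_1,\dots,x_n)$ and $g_{ij}=\delta_{ij}\varepsilon_i$, $\varepsilon_i=\pm1$, and let $F^m$, $m\ge1$, be a Ricci-flat semi-Riemannian manifold. Let $\varphi(\xi)$ and $f(\xi)$ be any positive differentiable functions, where $\xi=\sum_{i=1}^n\alpha_ix_i$, $\alpha_i\in\mathbb{R}$, and $\sum_{i=1}^n\varepsilon_i\alpha_i^2=0$. Then the function $h(\xi)$ given by $$h(\xi)=\int\left(\varphi^{-2}\left[\int\Big(m\frac{f''}{f}\varphi^2+2m\varphi\varphi'\frac{f'}{f}-(n-2)\varphi\varphi''\Big)d\xi+c_4\right]\right)d\xi+c_5,\qquad c_4,c_5\in\mathbb{R},$$ satisfies $$(n-2)f\varphi''+f\varphi h''-m\varphi f''-2m\varphi'f'+2f\varphi'h'=0,$$ and $M=(\mathbb{R}^n,\overline g)\times_fF^m$, with $\overline g=\frac1{\varphi^2}g$, is a steady gradient Ricci soliton with $h$ as potential function.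
   Context: Here $'$ denotes $d/d\xi$ and differentiable means smooth. A semi-Riemannian manifold $(M,\widetilde g)$ is a steady gradient Ricci soliton with potential function $h$ if $\mathrm{Ric}_{\widetilde g}+\mathrm{Hess}_{\widetilde g}(h)=0$. The warped product $B\times_fF$ of semi-Riemannian manifolds $(B,g_B)$, $(F,g_F)$ with warping function $f>0$ on $B$ is $B\times F$ with metric $g_B+f^2g_F$. Functions on the base are regarded as functions on $M$ via the projection. *)

theory Defs
  imports "HOL-Analysis.Analysis"
begin

section \<open>Smooth functions on open sets and indefinite integrals\<close>

text \<open>The partial derivative in the direction of a basis vector. On the reals, where
  \<^term>\<open>Basis = {1::real}\<close>, it is the ordinary derivative.\<close>

definition pd :: "'a::euclidean_space \<Rightarrow> ('a \<Rightarrow> real) \<Rightarrow> 'a \<Rightarrow> real" where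
  "pd b u x = deriv (\<lambda>t. u (x + t *\<^sub>R b)) 0"

text \<open>On an open set this is smoothness: all iterated partial derivatives exist and, being
  (Frechet) differentiable themselves, are continuous. It is only used for open sets.\<close>

definition smooth_on :: "'a::euclidean_space set \<Rightarrow> ('a \<Rightarrow> real) \<Rightarrow> bool" where
  "smooth_on S u \<longleftrightarrow> (\<forall>bs. set bs \<subseteq> Basis \<longrightarrow> (\<forall>x\<in>S. fold pd bs u differentiable (at x)))"

text \<open>The indefinite integral, as the set of all primitives on the real line.\<close>

definition indefinite_integral :: "(real \<Rightarrow> real) \<Rightarrow> (real \<Rightarrow> real) set" where
  "indefinite_integral u = {U. \<forall>x. (U has_real_derivative u x) (at x)}"

lemma indefinite_integral_nonempty:
  assumes "continuous_on UNIV u"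
  shows "indefinite_integral u \<noteq> {}"
proof -
  have "\<exists>U. \<forall>x. - \<infinity> < ereal x \<longrightarrow> ereal x < \<infinity> \<longrightarrow> (U has_vector_derivative u x) (at x)"
    using assms by (intro einterval_antiderivative) (auto simp: continuous_on_eq_continuous_at)
  then show ?thesis
    by (auto simp: indefinite_integral_def has_real_derivative_iff_has_vector_derivative)
qed


section \<open>Smooth manifolds\<close>

text \<open>A manifold of dimension \<^term>\<open>CARD('i)\<close> is given by a topological space and an atlas,
  that is, a family of charts, here indexed by \<open>'c\<close>. The domain and the
  coordinate map of a chart are separate fields, and \<open>chart_map M c\<close> is relevant only on
  \<open>chart_dom M c\<close>.\<close>

record ('p, 'c, 'i) manifold =
  topology_of :: "'p topology"
  charts :: "'c set"
  chart_dom :: "'c \<Rightarrow> 'p set"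
  chart_map :: "'c \<Rightarrow> 'p \<Rightarrow> real ^ 'i"

definition chart_inv :: "('p, 'c, 'i::finite) manifold \<Rightarrow> 'c \<Rightarrow> real ^ 'i \<Rightarrow> 'p" where
  "chart_inv M c = inv_into (chart_dom M c) (chart_map M c)"

definition second_countable_space :: "'p topology \<Rightarrow> bool" where
  "second_countable_space X \<longleftrightarrow>
     (\<exists>\<B>. countable \<B> \<and> (\<forall>B\<in>\<B>. openin X B) \<and> (\<forall>U. openin X U \<longrightarrow> (\<exists>\<U>\<subseteq>\<B>. U = \<Union>\<U>)))"

definition smooth_manifold :: "('p, 'c, 'i::finite) manifold \<Rightarrow> bool" where
  "smooth_manifold M \<longleftrightarrow>
     Hausdorff_space (topology_of M) \<and>
     second_countable_space (topology_of M) \<and>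
     (\<Union>c\<in>charts M. chart_dom M c) = topspace (topology_of M) \<and>
     (\<forall>c\<in>charts M. openin (topology_of M) (chart_dom M c) \<and>
        open (chart_map M c ` chart_dom M c) \<and>
        homeomorphic_map (subtopology (topology_of M) (chart_dom M c))
          (top_of_set (chart_map M c ` chart_dom M c)) (chart_map M c)) \<and>
     (\<forall>c\<in>charts M. \<forall>c'\<in>charts M. \<forall>i.
        smooth_on (chart_map M c ` (chart_dom M c \<inter> chart_dom M c'))
          (\<lambda>x. chart_map M c' (chart_inv M c x) $ i))"

definition smooth_in_chart :: "('p, 'c, 'i::finite) manifold \<Rightarrow> 'c \<Rightarrow> ('p \<Rightarrow> real) \<Rightarrow> bool" where
  "smooth_in_chart M c u \<longleftrightarrow>
     smooth_on (chart_map M c ` chart_dom M c) (\<lambda>x. u (chart_inv M c x))"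

definition smooth_function :: "('p, 'c, 'i::finite) manifold \<Rightarrow> ('p \<Rightarrow> real) \<Rightarrow> bool" where
  "smooth_function M u \<longleftrightarrow> (\<forall>c\<in>charts M. smooth_in_chart M c u)"

text \<open>The \<open>i\<close>-th coordinate vector field of the chart \<open>c\<close>, applied to a function \<open>u\<close> on \<open>M\<close>.\<close>

definition coord_deriv ::
    "('p, 'c, 'i::finite) manifold \<Rightarrow> 'c \<Rightarrow> 'i \<Rightarrow> ('p \<Rightarrow> real) \<Rightarrow> 'p \<Rightarrow> real" where
  "coord_deriv M c i u p = pd (axis i 1) (\<lambda>x. u (chart_inv M c x)) (chart_map M c p)"


section \<open>Semi-Riemannian metrics, Ricci tensor and Hessian\<close>

text \<open>A covariant 2-tensor field is represented by its components: \<open>g c p $ i $ j\<close> is its value on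
  the \<open>i\<close>-th and \<open>j\<close>-th coordinate vectors of the chart \<open>c\<close> at the point \<open>p\<close> of the
  manifold. For a metric the transformation law of the components is required explicitly.\<close>

type_synonym ('p, 'c, 'i) tensor2 = "'c \<Rightarrow> 'p \<Rightarrow> real ^ 'i ^ 'i"

text \<open>The index of a scalar product is the number of timelike vectors in an orthonormal basis;
  the columns of \<open>P\<close> are such a basis. By Sylvester's law of inertia, \<open>k\<close> is unique.\<close>

definition has_index :: "real ^ 'i ^ 'i::finite \<Rightarrow> nat \<Rightarrow> bool" where
  "has_index A k \<longleftrightarrow>
     (\<exists>(P :: real ^ 'i ^ 'i) e. invertible P \<and> (\<forall>i. e i = 1 \<or> e i = -1) \<and>
        transpose P ** A ** P = (\<chi> i j. if i = j then e i else 0) \<and>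
        card {i. e i = -1} = k)"

definition semi_riemannian_metric ::
    "('p, 'c, 'i::finite) manifold \<Rightarrow> ('p, 'c, 'i) tensor2 \<Rightarrow> bool" where
  "semi_riemannian_metric M g \<longleftrightarrow>
     (\<forall>c\<in>charts M. \<forall>i j. smooth_in_chart M c (\<lambda>p. g c p $ i $ j)) \<and>
     (\<forall>c\<in>charts M. \<forall>p\<in>chart_dom M c. transpose (g c p) = g c p \<and> invertible (g c p)) \<and>
     (\<forall>c\<in>charts M. \<forall>c'\<in>charts M. \<forall>p\<in>chart_dom M c \<inter> chart_dom M c'. \<forall>i j.
        g c p $ i $ j =
          (\<Sum>k\<in>UNIV. \<Sum>l\<in>UNIV. coord_deriv M c i (\<lambda>q. chart_map M c' q $ k) p *
             coord_deriv M c j (\<lambda>q. chart_map M c' q $ l) p * g c' p $ k $ l)) \<and>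
     (\<exists>\<nu>. \<forall>c\<in>charts M. \<forall>p\<in>chart_dom M c. has_index (g c p) \<nu>)"

definition semi_riemannian_manifold ::
    "('p, 'c, 'i::finite) manifold \<Rightarrow> ('p, 'c, 'i) tensor2 \<Rightarrow> bool" where
  "semi_riemannian_manifold M g \<longleftrightarrow> smooth_manifold M \<and> semi_riemannian_metric M g"

text \<open>The Christoffel symbol \<open>\<Gamma>\<^sup>k\<^sub>i\<^sub>j\<close> of the Levi-Civita connection, with the upper index first.\<close>

definition christoffel :: "('p, 'c, 'i::finite) manifold \<Rightarrow> ('p, 'c, 'i) tensor2 \<Rightarrow>
    'c \<Rightarrow> 'i \<Rightarrow> 'i \<Rightarrow> 'i \<Rightarrow> 'p \<Rightarrow> real" where
  "christoffel M g c k i j p =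
     1 / 2 * (\<Sum>l\<in>UNIV. matrix_inv (g c p) $ k $ l *
        (coord_deriv M c i (\<lambda>q. g c q $ j $ l) p
         + coord_deriv M c j (\<lambda>q. g c q $ i $ l) p
         - coord_deriv M c l (\<lambda>q. g c q $ i $ j) p))"

text \<open>The component \<open>R\<^sup>l\<^sub>k\<^sub>i\<^sub>j\<close> determined by
  \<open>R(\<partial>\<^sub>i, \<partial>\<^sub>j) \<partial>\<^sub>k = \<nabla>\<^sub>i \<nabla>\<^sub>j \<partial>\<^sub>k - \<nabla>\<^sub>j \<nabla>\<^sub>i \<partial>\<^sub>k = (\<Sum>l. R\<^sup>l\<^sub>k\<^sub>i\<^sub>j \<partial>\<^sub>l)\<close>. With the Ricci tensor as the trace
  of \<open>X \<mapsto> R(X, Y) Z\<close>, round spheres have positive Ricci curvature.\<close>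

definition riemann :: "('p, 'c, 'i::finite) manifold \<Rightarrow> ('p, 'c, 'i) tensor2 \<Rightarrow>
    'c \<Rightarrow> 'i \<Rightarrow> 'i \<Rightarrow> 'i \<Rightarrow> 'i \<Rightarrow> 'p \<Rightarrow> real" where
  "riemann M g c l k i j p =
     coord_deriv M c i (christoffel M g c l j k) p
     - coord_deriv M c j (christoffel M g c l i k) p
     + (\<Sum>r\<in>UNIV. christoffel M g c l i r p * christoffel M g c r j k p
                 - christoffel M g c l j r p * christoffel M g c r i k p)"

definition ricci :: "('p, 'c, 'i::finite) manifold \<Rightarrow> ('p, 'c, 'i) tensor2 \<Rightarrow>
    'c \<Rightarrow> 'i \<Rightarrow> 'i \<Rightarrow> 'p \<Rightarrow> real" where
  "ricci M g c j k p = (\<Sum>i\<in>UNIV. riemann M g c i k i j p)"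

definition hessian :: "('p, 'c, 'i::finite) manifold \<Rightarrow> ('p, 'c, 'i) tensor2 \<Rightarrow>
    ('p \<Rightarrow> real) \<Rightarrow> 'c \<Rightarrow> 'i \<Rightarrow> 'i \<Rightarrow> 'p \<Rightarrow> real" where
  "hessian M g u c i j p =
     coord_deriv M c i (coord_deriv M c j u) p
     - (\<Sum>k\<in>UNIV. christoffel M g c k i j p * coord_deriv M c k u p)"

definition ricci_flat :: "('p, 'c, 'i::finite) manifold \<Rightarrow> ('p, 'c, 'i) tensor2 \<Rightarrow> bool" where
  "ricci_flat M g \<longleftrightarrow> (\<forall>c\<in>charts M. \<forall>p\<in>chart_dom M c. \<forall>i j. ricci M g c i j p = 0)"

definition steady_gradient_ricci_soliton ::
    "('p, 'c, 'i::finite) manifold \<Rightarrow> ('p, 'c, 'i) tensor2 \<Rightarrow> ('p \<Rightarrow> real) \<Rightarrow> bool" where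
  "steady_gradient_ricci_soliton M g h \<longleftrightarrow>
     semi_riemannian_manifold M g \<and> smooth_function M h \<and>
     (\<forall>c\<in>charts M. \<forall>p\<in>chart_dom M c. \<forall>i j. ricci M g c i j p + hessian M g h c i j p = 0)"


section \<open>Pseudo-Euclidean space and warped products\<close>

definition euclidean_manifold :: "(real ^ 'n, unit, 'n::finite) manifold" where
  "euclidean_manifold =
     \<lparr>topology_of = euclidean, charts = UNIV, chart_dom = (\<lambda>_. UNIV), chart_map = (\<lambda>_ x. x)\<rparr>"

definition pseudo_euclidean_metric :: "('n::finite \<Rightarrow> real) \<Rightarrow> (real ^ 'n, unit, 'n) tensor2" where
  "pseudo_euclidean_metric \<epsilon> = (\<lambda>_ _. \<chi> i j. if i = j then \<epsilon> i else 0)"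

definition conformal_metric ::
    "('p \<Rightarrow> real) \<Rightarrow> ('p, 'c, 'i::finite) tensor2 \<Rightarrow> ('p, 'c, 'i) tensor2" where
  "conformal_metric \<phi> g = (\<lambda>c p. (1 / (\<phi> p)\<^sup>2) *\<^sub>R g c p)"

text \<open>Charts of the product are products of charts; their coordinates are indexed by the disjoint
  sum of the two index types.\<close>

definition product_manifold ::
    "('p, 'c, 'i::finite) manifold \<Rightarrow> ('q, 'd, 'j::finite) manifold \<Rightarrow> ('p \<times> 'q, 'c \<times> 'd, 'i + 'j) manifold" where
  "product_manifold B F =
     \<lparr>topology_of = prod_topology (topology_of B) (topology_of F),
      charts = charts B \<times> charts F,
      chart_dom = (\<lambda>(c, d). chart_dom B c \<times> chart_dom F d),
      chart_map = (\<lambda>(c, d) (p, q). \<chi> s. case s of Inl i \<Rightarrow> chart_map B c p $ i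
                                               | Inr a \<Rightarrow> chart_map F d q $ a)\<rparr>"

definition warped_product_metric ::
    "('p, 'c, 'i::finite) tensor2 \<Rightarrow> ('p \<Rightarrow> real) \<Rightarrow> ('q, 'd, 'j::finite) tensor2
      \<Rightarrow> ('p \<times> 'q, 'c \<times> 'd, 'i + 'j) tensor2" where
  "warped_product_metric gB f gF = (\<lambda>(c, d) (p, q). \<chi> s t.
     case (s, t) of
       (Inl i, Inl j) \<Rightarrow> gB c p $ i $ j
     | (Inr a, Inr b) \<Rightarrow> (f p)\<^sup>2 * gF d q $ a $ b
     | _ \<Rightarrow> 0)"

end

theory Submission
  imports Defs
begin

text \<open>Since \<open>\<alpha>\<close> is null, every term \<open>\<Sum>i. \<epsilon> i * (\<alpha> i)\<^sup>2\<close> that comes from a squared gradient or a Laplacian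
  of a function of \<open>\<xi>\<close> vanishes. Hence the mixed components of the Ricci tensor of the warped product
  are zero, its fibre components are those of \<open>F\<close>, and its base components are a function of \<open>\<xi>\<close>
  times \<open>\<alpha> j * \<alpha> k\<close>; the Hessian of \<open>h\<close> has the same shape, with zero fibre components. The soliton
  equation thus reduces to a single ordinary differential equation for \<open>h\<close>, which is
  \<open>(\<phi>\<^sup>2 h')' = m \<phi>\<^sup>2 f'' / f + 2 m \<phi> \<phi>' f' / f - (n - 2) \<phi> \<phi>''\<close> after multiplication by \<open>\<phi> / f\<close>.\<close>

section \<open>Calculus of smooth functions\<close>

text \<open>Metrics and curvature are given by chart components, so the Ricci tensor is found by
  direct computation in product charts. Separation of variables keeps this short: with the fibre
  point fixed, every metric component and every Christoffel symbol is a function of \<xi> times a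
  constant, and \<xi> is linear, so a base derivative is an ordinary derivative times some
  \<open>\<alpha> i\<close>. What remains is to contract the constant coefficients
  \<open>\<kappa>\<close> of the conformally flat base. The factor n - 2 arises there twice, as the
  coefficient of \<open>\<psi>'\<close> and as 2 n - (n + 2) in front of
  \<open>\<psi>\<^sup>2\<close>, where \<open>\<psi> = \<phi>' / \<phi>\<close>; the two terms
  combine to \<open>\<phi>'' / \<phi>\<close>. The other obstacle is that smoothness means
  differentiability of all iterated partial derivatives. Formulas for higher derivatives of products
  and compositions are avoided by exhibiting classes of functions closed under differentiation. G
  and H are merely primitives; their smoothness is inherited from the integrands.\<close>

lemma pd_has_derivative:
  assumes "(u has_derivative D) (at x)"
  shows "pd b u x = D b"
proof -
  interpret D: bounded_linear D using assms by (rule has_derivative_bounded_linear)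
  have "((\<lambda>t. x + t *\<^sub>R b) has_derivative (\<lambda>t. t *\<^sub>R b)) (at 0)"
    by (auto intro!: derivative_eq_intros)
  moreover have "(u has_derivative D) (at (x + 0 *\<^sub>R b))" using assms by simp
  ultimately have "((\<lambda>t. u (x + t *\<^sub>R b)) has_derivative (\<lambda>t. D (t *\<^sub>R b))) (at 0)"
    by (rule has_derivative_compose)
  then have "((\<lambda>t. u (x + t *\<^sub>R b)) has_field_derivative D b) (at 0)"
    by (simp add: has_field_derivative_def D.scale mult_commute_abs)
  then show ?thesis unfolding pd_def by (rule DERIV_imp_deriv)
qed

lemma eventually_line_in_open:
  fixes x :: "'a::real_normed_vector"
  assumes "open S" "x \<in> S"
  shows "\<forall>\<^sub>F t in nhds (0::real). x + t *\<^sub>R b \<in> S"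
proof -
  have "((\<lambda>t. x + t *\<^sub>R b) \<longlongrightarrow> x + 0 *\<^sub>R b) (nhds (0::real))"
    by (intro tendsto_intros) (simp add: filterlim_ident)
  then show ?thesis using assms by (auto intro: topological_tendstoD)
qed

lemma pd_cong:
  assumes "open S" "x \<in> S" "\<And>y. y \<in> S \<Longrightarrow> u y = v y"
  shows "pd b u x = pd b v x"
  unfolding pd_def
  by (intro deriv_cong_ev eventually_mono[OF eventually_line_in_open[OF assms(1,2)]] assms(3)) simp_all

lemma pd_real: "pd 1 u = deriv u"
  by (rule ext, subst deriv_shift_0) (simp add: pd_def o_def)

text \<open>Agreement on the whole open set, not only at x, survives each differentiation; hence the
  induction generalises over u and v.\<close>

lemma fold_pd_cong:
  assumes "open S" "\<And>y. y \<in> S \<Longrightarrow> u y = v y" "x \<in> S"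
  shows "fold pd bs u x = fold pd bs v x"
  using assms(2)
proof (induction bs arbitrary: u v)
  case Nil
  then show ?case using assms(3) by simp
next
  case (Cons b bs)
  have "fold pd bs (pd b u) x = fold pd bs (pd b v) x"
    by (rule Cons.IH) (rule pd_cong[OF assms(1) _ Cons.prems])
  then show ?case by simp
qed

lemma differentiable_cong_open:
  fixes u v :: "'a::real_normed_vector \<Rightarrow> 'b::real_normed_vector"
  assumes "open S" "x \<in> S" "\<And>y. y \<in> S \<Longrightarrow> u y = v y" "u differentiable (at x)"
  shows "v differentiable (at x)"
  using assms has_derivative_transform_within_open unfolding differentiable_def by blast

lemma smooth_on_cong:
  fixes S :: "'a::euclidean_space set"
  assumes "open S" "\<And>y. y \<in> S \<Longrightarrow> u y = v y" "smooth_on S u"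
  shows "smooth_on S v"
  unfolding smooth_on_def
proof (intro allI impI ballI)
  fix bs x assume "set bs \<subseteq> (Basis :: 'a set)" "x \<in> S"
  then show "fold pd bs v differentiable (at x)"
    using assms differentiable_cong_open[OF assms(1), of x "fold pd bs u" "fold pd bs v"]
      fold_pd_cong[OF assms(1), of u v]
    by (simp add: smooth_on_def)
qed

lemma smooth_on_differentiable: "smooth_on S u \<Longrightarrow> x \<in> S \<Longrightarrow> u differentiable (at x)"
  using smooth_on_def[of S u] by (metis empty_subsetI fold_simps(1) list.set(1))

lemma smooth_on_pd:
  fixes S :: "'a::euclidean_space set"
  shows "smooth_on S u \<Longrightarrow> b \<in> Basis \<Longrightarrow> smooth_on S (pd b u)"
  unfolding smooth_on_def
proof (intro allI impI ballI)
  fix bs :: "'a list" and x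
  assume "\<forall>bs. set bs \<subseteq> Basis \<longrightarrow> (\<forall>x\<in>S. fold pd bs u differentiable (at x))"
    "b \<in> Basis" "set bs \<subseteq> Basis" "x \<in> S"
  then show "fold pd bs (pd b u) differentiable (at x)"
    by (auto dest!: spec[of _ "b # bs"])
qed

lemma smooth_onI_pd:
  fixes S :: "'a::euclidean_space set"
  assumes "\<And>x. x \<in> S \<Longrightarrow> u differentiable (at x)" "\<And>b. b \<in> Basis \<Longrightarrow> smooth_on S (pd b u)"
  shows "smooth_on S u"
  unfolding smooth_on_def
proof (intro allI impI ballI)
  fix bs :: "'a list" and x assume "set bs \<subseteq> Basis" "x \<in> S"
  then show "fold pd bs u differentiable (at x)"
    using assms by (cases bs) (auto simp: smooth_on_def)
qed

text \<open>Each iterated partial derivative of a member of C is again a member up to equality on S,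
  hence differentiable. A good choice of C replaces Leibniz or Faa di Bruno formulas. Equality is
  asked only on S because \<open>pd\<close> is uncontrolled elsewhere.\<close>

lemma smooth_on_coinduct:
  fixes S :: "'a::euclidean_space set"
  assumes "open S" "u \<in> C"
    and "\<And>v x. v \<in> C \<Longrightarrow> x \<in> S \<Longrightarrow> v differentiable (at x)"
    and "\<And>v b. v \<in> C \<Longrightarrow> b \<in> Basis \<Longrightarrow> \<exists>w\<in>C. \<forall>x\<in>S. pd b v x = w x"
  shows "smooth_on S u"
  unfolding smooth_on_def
proof (intro allI impI ballI)
  fix bs x assume "set bs \<subseteq> (Basis :: 'a set)" "x \<in> S"
  then show "fold pd bs u differentiable (at x)"
    using \<open>u \<in> C\<close>
  proof (induction bs arbitrary: u)
    case Nil
    then show ?case using assms(3) by simp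
  next
    case (Cons b bs)
    then obtain w where w: "w \<in> C" "\<And>x. x \<in> S \<Longrightarrow> pd b u x = w x"
      using assms(4)[of u b] by auto
    have "fold pd bs w differentiable (at x)" using Cons w by simp
    then show ?case
      using differentiable_cong_open[OF assms(1), of x "fold pd bs w" "fold pd (b # bs) u"]
        fold_pd_cong[OF assms(1), of w "pd b u"] w Cons.prems by simp
  qed
qed

lemma smooth_on_const: "open S \<Longrightarrow> smooth_on S (\<lambda>_. c)"
  by (rule smooth_on_coinduct[where C = "range (\<lambda>c _. c)"])
    (auto simp: pd_has_derivative[OF has_derivative_const])

lemma smooth_on_linear:
  assumes "open S" "bounded_linear u"
  shows "smooth_on S u"
proof (rule smooth_onI_pd)
  have "(u has_derivative u) (at x)" for x
    using assms(2) by (rule bounded_linear_imp_has_derivative)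
  then have "pd b u = (\<lambda>_. u b)" for b by (auto simp: pd_has_derivative)
  then show "smooth_on S (pd b u)" for b using assms(1) by (simp add: smooth_on_const)
  show "u differentiable (at x)" for x
    using assms(2) by (simp add: bounded_linear_imp_differentiable)
qed

text \<open>The algebra generated by the smooth functions and the compositions with \<open>\<Phi>\<close> is closed
  under differentiation, by the product and chain rules.\<close>

inductive_set pullback_algebra ::
    "'a::euclidean_space set \<Rightarrow> 'b::euclidean_space set \<Rightarrow> ('a \<Rightarrow> 'b) \<Rightarrow> ('a \<Rightarrow> real) set"
  for S T \<Phi> where
  smooth: "smooth_on S u \<Longrightarrow> u \<in> pullback_algebra S T \<Phi>"
| pullback: "smooth_on T u \<Longrightarrow> (\<lambda>x. u (\<Phi> x)) \<in> pullback_algebra S T \<Phi>"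
| add: "u \<in> pullback_algebra S T \<Phi> \<Longrightarrow> v \<in> pullback_algebra S T \<Phi> \<Longrightarrow> (\<lambda>x. u x + v x) \<in> pullback_algebra S T \<Phi>"
| mult: "u \<in> pullback_algebra S T \<Phi> \<Longrightarrow> v \<in> pullback_algebra S T \<Phi> \<Longrightarrow> (\<lambda>x. u x * v x) \<in> pullback_algebra S T \<Phi>"

context
  fixes S :: "'a::euclidean_space set" and T :: "'b::euclidean_space set" and \<Phi> :: "'a \<Rightarrow> 'b"
  assumes open_S: "open S" and \<Phi>_in: "\<Phi> ` S \<subseteq> T"
    and smooth_\<Phi>: "\<And>b. b \<in> Basis \<Longrightarrow> smooth_on S (\<lambda>x. \<Phi> x \<bullet> b)"
begin

lemma differentiable_\<Phi>: "x \<in> S \<Longrightarrow> \<Phi> differentiable (at x)"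
  using smooth_\<Phi> smooth_on_differentiable differentiable_componentwise_within[of \<Phi> x UNIV] by blast

lemma pullback_algebra_differentiable:
  "v \<in> pullback_algebra S T \<Phi> \<Longrightarrow> x \<in> S \<Longrightarrow> v differentiable (at x)"
proof (induction rule: pullback_algebra.induct)
  case (pullback u)
  then have "u differentiable (at (\<Phi> x))" using \<Phi>_in by (auto intro: smooth_on_differentiable)
  from differentiable_chain_at[OF differentiable_\<Phi>[OF \<open>x \<in> S\<close>] this] show ?case by (simp add: o_def)
qed (auto intro: smooth_on_differentiable)

lemma pullback_algebra_sum:
  "finite I \<Longrightarrow> (\<And>i. i \<in> I \<Longrightarrow> v i \<in> pullback_algebra S T \<Phi>) \<Longrightarrow> (\<lambda>x. \<Sum>i\<in>I. v i x) \<in> pullback_algebra S T \<Phi>"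
  by (induction I rule: finite_induct)
    (auto intro: pullback_algebra.intros smooth_on_const[OF open_S])

text \<open>The chain rule turns the derivative of a pullback into a sum of products of pullbacks
  with derivatives of the components of \<Phi>. The latter are smooth on S, which is why the algebra
  contains both kinds of generators.\<close>

lemma pullback_algebra_pd:
  assumes "v \<in> pullback_algebra S T \<Phi>" "b \<in> Basis"
  shows "\<exists>w\<in>pullback_algebra S T \<Phi>. \<forall>x\<in>S. pd b v x = w x"
  using assms(1)
proof (induction rule: pullback_algebra.induct)
  case (smooth u)
  then show ?case using assms(2) by (blast intro: pullback_algebra.smooth smooth_on_pd)
next
  case (pullback u)
  show ?case
  proof (intro bexI ballI)
    show "(\<lambda>x. \<Sum>c\<in>Basis. pd c u (\<Phi> x) * pd b (\<lambda>x. \<Phi> x \<bullet> c) x) \<in> pullback_algebra S T \<Phi>"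
      using assms(2) pullback
      by (intro pullback_algebra_sum pullback_algebra.mult pullback_algebra.smooth
          pullback_algebra.pullback[where u = "pd _ u"] smooth_on_pd smooth_\<Phi>) auto
    fix x assume x: "x \<in> S"
    obtain D where D: "(\<Phi> has_derivative D) (at x)"
      using differentiable_\<Phi>[OF x] by (auto simp: differentiable_def)
    obtain E where E: "(u has_derivative E) (at (\<Phi> x))"
      using smooth_on_differentiable[OF pullback, of "\<Phi> x"] \<Phi>_in x by (auto simp: differentiable_def)
    interpret E: bounded_linear E using E by (rule has_derivative_bounded_linear)
    have "pd b (\<lambda>x. u (\<Phi> x)) x = E (D b)"
      by (rule pd_has_derivative[OF has_derivative_compose[OF D E]])
    \<comment> \<open>Expanding \<open>D b\<close> in the basis turns the abstract chain rule
      \<open>E (D b)\<close> into partial derivatives of u and of the components of \<Phi>.\<close>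
    also have "\<dots> = E (\<Sum>c\<in>Basis. (D b \<bullet> c) *\<^sub>R c)" by (simp add: euclidean_representation)
    also have "\<dots> = (\<Sum>c\<in>Basis. (D b \<bullet> c) * E c)" by (simp add: E.sum E.scale)
    also have "\<dots> = (\<Sum>c\<in>Basis. pd c u (\<Phi> x) * pd b (\<lambda>x. \<Phi> x \<bullet> c) x)"
      by (simp add: pd_has_derivative[OF E] pd_has_derivative[OF has_derivative_inner_left[OF D]] mult.commute)
    finally show "pd b (\<lambda>x. u (\<Phi> x)) x = (\<Sum>c\<in>Basis. pd c u (\<Phi> x) * pd b (\<lambda>x. \<Phi> x \<bullet> c) x)" .
  qed
next
  case (add u v)
  then obtain u' v' where w: "u' \<in> pullback_algebra S T \<Phi>" "v' \<in> pullback_algebra S T \<Phi>"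
    "\<And>x. x \<in> S \<Longrightarrow> pd b u x = u' x" "\<And>x. x \<in> S \<Longrightarrow> pd b v x = v' x" by blast
  show ?case
  proof (intro bexI ballI)
    show "(\<lambda>x. u' x + v' x) \<in> pullback_algebra S T \<Phi>" using w by (intro pullback_algebra.add)
    fix x assume x: "x \<in> S"
    obtain D E where "(u has_derivative D) (at x)" "(v has_derivative E) (at x)"
      using add.hyps pullback_algebra_differentiable[OF _ x] unfolding differentiable_def by blast
    note this[THEN pd_has_derivative, of b] pd_has_derivative[OF has_derivative_add[OF this], of b]
    then show "pd b (\<lambda>x. u x + v x) x = u' x + v' x" using w x by simp
  qed
next
  case (mult u v)
  then obtain u' v' where w: "u' \<in> pullback_algebra S T \<Phi>" "v' \<in> pullback_algebra S T \<Phi>"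
    "\<And>x. x \<in> S \<Longrightarrow> pd b u x = u' x" "\<And>x. x \<in> S \<Longrightarrow> pd b v x = v' x" by blast
  show ?case
  proof (intro bexI ballI)
    show "(\<lambda>x. u x * v' x + u' x * v x) \<in> pullback_algebra S T \<Phi>"
      using w mult.hyps by (intro pullback_algebra.add pullback_algebra.mult)
    fix x assume x: "x \<in> S"
    obtain D E where "(u has_derivative D) (at x)" "(v has_derivative E) (at x)"
      using mult.hyps pullback_algebra_differentiable[OF _ x] unfolding differentiable_def by blast
    note this[THEN pd_has_derivative, of b] pd_has_derivative[OF has_derivative_mult[OF this], of b]
    then show "pd b (\<lambda>x. u x * v x) x = u x * v' x + u' x * v x" using w x by simp
  qed
qed

lemma smooth_on_pullback_algebra: "v \<in> pullback_algebra S T \<Phi> \<Longrightarrow> smooth_on S v"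
  by (rule smooth_on_coinduct[OF open_S, of _ "pullback_algebra S T \<Phi>"])
    (auto intro: pullback_algebra_differentiable pullback_algebra_pd)

lemma smooth_on_compose: "smooth_on T u \<Longrightarrow> smooth_on S (\<lambda>x. u (\<Phi> x))"
  by (rule smooth_on_pullback_algebra[OF pullback_algebra.pullback])

end

text \<open>The dummy map \<Phi> = 0 pulls back constants only; it makes the closure of
  \<open>pullback_algebra\<close> under products available for functions on S. Sums are treated in
  the same way.\<close>

lemma smooth_on_mult:
  assumes "open S" "smooth_on S u" "smooth_on S v"
  shows "smooth_on S (\<lambda>x. u x * v x)"
  by (rule smooth_on_pullback_algebra[where T = "UNIV :: real set" and \<Phi> = "\<lambda>_. 0"])
    (use assms in \<open>auto intro: pullback_algebra.mult pullback_algebra.smooth smooth_on_const\<close>)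

lemma smooth_on_add:
  assumes "open S" "smooth_on S u" "smooth_on S v"
  shows "smooth_on S (\<lambda>x. u x + v x)"
  by (rule smooth_on_pullback_algebra[where T = "UNIV :: real set" and \<Phi> = "\<lambda>_. 0"])
    (use assms in \<open>auto intro: pullback_algebra.add pullback_algebra.smooth smooth_on_const\<close>)

lemma smooth_on_compose_real:
  fixes u :: "'a::euclidean_space \<Rightarrow> real"
  assumes "open S" "u ` S \<subseteq> T" "smooth_on S u" "smooth_on T v"
  shows "smooth_on S (\<lambda>x. v (u x))"
  by (rule smooth_on_compose[where T = T and \<Phi> = u]) (use assms in auto)

text \<open>The functions \<open>c * inverse (x ^ k)\<close> form a class closed under
  differentiation: a derivative raises k by one and multiplies c by -k. The inverse itself is the
  member c = k = 1.\<close>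

lemma smooth_on_inverse_real: "smooth_on {0<..} (inverse :: real \<Rightarrow> real)"
proof (rule smooth_on_coinduct[where C = "range (\<lambda>(c, k) x. c * inverse (x ^ k))"])
  show "inverse \<in> range (\<lambda>(c, k) x :: real. c * inverse (x ^ k))"
    by (rule range_eqI[of _ _ "(1, 1)"]) auto
  fix v :: "real \<Rightarrow> real" assume "v \<in> range (\<lambda>(c, k) x. c * inverse (x ^ k))"
  then obtain c k where v: "v = (\<lambda>x. c * inverse (x ^ k))" by auto
  have *: "(v has_real_derivative - c * real k * inverse (x ^ Suc k)) (at x)" if "x > 0" for x
  proof -
    have "((\<lambda>x. c * inverse (x ^ k)) has_real_derivative
        c * (- (inverse (x ^ k) * (real k * x ^ (k - 1)) * inverse (x ^ k)))) (at x)"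
      using that by (auto intro!: derivative_eq_intros)
    moreover have "x ^ k * inverse (x ^ k) = 1" using that by simp
    \<comment> \<open>For k = 0 the truncated exponent k - 1 is harmless, since the factor
      \<open>real k\<close> vanishes.\<close>
    then have "real k * x ^ (k - 1) * inverse (x ^ k) = real k * inverse x"
      using that by (cases k) auto
    ultimately show ?thesis
      unfolding v by (elim DERIV_cong) auto
  qed
  show "v differentiable (at x)" if "x \<in> {0<..}" for x
    using *[of x] that by (auto simp: real_differentiable_def)
  show "\<exists>w\<in>range (\<lambda>(c, k) x. c * inverse (x ^ k)). \<forall>x\<in>{0<..}. pd b v x = w x"
    if "b \<in> Basis" for b
  proof
    show "(\<lambda>x. - c * real k * inverse (x ^ Suc k)) \<in> range (\<lambda>(c, k) x. c * inverse (x ^ k))"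
      by (rule range_eqI[of _ _ "(- c * real k, Suc k)"]) auto
    show "\<forall>x\<in>{0<..}. pd b v x = - c * real k * inverse (x ^ Suc k)"
      using that DERIV_imp_deriv[OF *] by (simp add: pd_real)
  qed
qed auto

lemma smooth_on_inverse:
  assumes "open S" "smooth_on S u" "\<And>x. x \<in> S \<Longrightarrow> u x > 0"
  shows "smooth_on S (\<lambda>x. inverse (u x))"
  by (rule smooth_on_compose_real[OF assms(1) _ assms(2) smooth_on_inverse_real])
    (use assms(3) in auto)

lemma smooth_on_deriv: "smooth_on S u \<Longrightarrow> smooth_on S (deriv u)"
  using smooth_on_pd[of S u 1] by (simp add: pd_real)

lemma smooth_on_real_DERIV:
  "smooth_on S u \<Longrightarrow> x \<in> S \<Longrightarrow> (u has_real_derivative deriv u x) (at x)"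
  using smooth_on_differentiable by (auto simp: DERIV_deriv_iff_real_differentiable)

text \<open>The only first partial derivative of U is u, so all higher ones are those of u. This
  supplies the smoothness of G and h, for which only first derivatives are prescribed.\<close>

lemma smooth_on_antiderivative:
  assumes "\<And>x. (U has_real_derivative u x) (at x)" "smooth_on UNIV u"
  shows "smooth_on UNIV U"
proof (rule smooth_onI_pd)
  show "U differentiable (at x)" for x using assms(1) by (auto simp: real_differentiable_def)
  have "deriv U = u" using assms(1) by (auto intro: DERIV_imp_deriv)
  then show "smooth_on UNIV (pd b U)" if "b \<in> Basis" for b
    using that assms(2) by (simp add: pd_real)
qed


section \<open>Sums over disjoint unions and block matrices\<close>

lemma sum_UNIV_Plus:
  "(\<Sum>s\<in>(UNIV :: ('a::finite + 'b::finite) set). w s) = (\<Sum>i\<in>UNIV. w (Inl i)) + (\<Sum>a\<in>UNIV. w (Inr a))"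
  by (subst UNIV_sum, subst sum.union_disjoint) (auto simp: sum.reindex)

text \<open>\<open>matrix_inv\<close> is a choice of a two-sided inverse; uniqueness of such
  inverses allows it to be computed by guessing the result.\<close>

lemma matrix_inv_unique:
  fixes A A' :: "'a::semiring_1 ^ 'n ^ 'n"
  assumes "A ** A' = mat 1" "A' ** A = mat 1"
  shows "matrix_inv A = A'"
proof -
  have "A ** matrix_inv A = mat 1 \<and> matrix_inv A ** A = mat 1"
    unfolding matrix_inv_def using assms by (rule_tac someI) blast
  then show ?thesis using assms by (metis matrix_mul_assoc matrix_mul_lid matrix_mul_rid)
qed

lemma matrix_inv_works:
  fixes A :: "'a::semiring_1 ^ 'n ^ 'n"
  assumes "invertible A"
  shows "A ** matrix_inv A = mat 1" "matrix_inv A ** A = mat 1"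
  using assms matrix_inv_unique unfolding invertible_def by metis+

text \<open>Product charts take values in vectors indexed by a sum type, not in pairs of vectors.
  \<open>vec_join\<close> is the isomorphism between the two, with inverse given by
  \<open>vec_fst\<close> and \<open>vec_snd\<close>.\<close>

definition vec_join :: "'a ^ 'i \<Rightarrow> 'a ^ 'j \<Rightarrow> 'a ^ ('i::finite + 'j::finite)" where
  "vec_join x y = (\<chi> s. case s of Inl i \<Rightarrow> x $ i | Inr a \<Rightarrow> y $ a)"

definition vec_fst :: "'a ^ ('i::finite + 'j::finite) \<Rightarrow> 'a ^ 'i" where
  "vec_fst z = (\<chi> i. z $ Inl i)"

definition vec_snd :: "'a ^ ('i::finite + 'j::finite) \<Rightarrow> 'a ^ 'j" where
  "vec_snd z = (\<chi> a. z $ Inr a)"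

lemma vec_join_nth [simp]: "vec_join x y $ Inl i = x $ i" "vec_join x y $ Inr a = y $ a"
  by (simp_all add: vec_join_def)

lemma vec_fst_nth [simp]: "vec_fst z $ i = z $ Inl i"
  by (simp add: vec_fst_def)

lemma vec_snd_nth [simp]: "vec_snd z $ a = z $ Inr a"
  by (simp add: vec_snd_def)

lemma vec_eq_Plus_iff: "x = y \<longleftrightarrow> (\<forall>i. x $ Inl i = y $ Inl i) \<and> (\<forall>a. x $ Inr a = y $ Inr a)"
  by (auto simp: vec_eq_iff) (metis sum.exhaust)

lemma vec_join_fst_snd [simp]: "vec_join (vec_fst z) (vec_snd z) = z"
  by (simp add: vec_eq_Plus_iff)

lemma vec_fst_join [simp]: "vec_fst (vec_join x y) = x"
  by (simp add: vec_eq_iff)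

lemma vec_snd_join [simp]: "vec_snd (vec_join x y) = y"
  by (simp add: vec_eq_iff)

lemma vec_join_axis:
  fixes x :: "real ^ 'i::finite" and y :: "real ^ 'j::finite"
  shows "vec_join x y + t *\<^sub>R axis (Inl i) 1 = vec_join (x + t *\<^sub>R axis i 1) y"
    and "vec_join x y + t *\<^sub>R axis (Inr a) 1 = vec_join x (y + t *\<^sub>R axis a 1)"
  by (simp_all add: vec_eq_Plus_iff axis_def)

lemma continuous_on_vec_join:
  fixes x :: "'a::topological_space \<Rightarrow> real ^ 'i::finite" and y :: "'a \<Rightarrow> real ^ 'j::finite"
  assumes "continuous_on S x" "continuous_on S y"
  shows "continuous_on S (\<lambda>p. vec_join (x p) (y p))"
  unfolding vec_join_def
proof (rule continuous_on_vec_lambda)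
  show "continuous_on S (\<lambda>p. case s of Inl i \<Rightarrow> x p $ i | Inr a \<Rightarrow> y p $ a)" for s
    by (cases s) (auto intro: continuous_intros assms)
qed

lemma continuous_on_vec_fst: "continuous_on S (vec_fst :: real ^ ('i::finite + 'j::finite) \<Rightarrow> _)"
  unfolding vec_fst_def by (intro continuous_intros)

lemma continuous_on_vec_snd: "continuous_on S (vec_snd :: real ^ ('i::finite + 'j::finite) \<Rightarrow> _)"
  unfolding vec_snd_def by (intro continuous_intros)

text \<open>The case distinction mirrors that of \<open>warped_product_metric\<close>, so that
  inverse, transpose and index of a warped metric are read off from its two blocks.\<close>

definition block_diag :: "real ^ 'i ^ 'i \<Rightarrow> real ^ 'j ^ 'j \<Rightarrow> real ^ ('i::finite + 'j::finite) ^ ('i + 'j)" where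
  "block_diag A B = (\<chi> s t. case (s, t) of
     (Inl i, Inl j) \<Rightarrow> A $ i $ j | (Inr a, Inr b) \<Rightarrow> B $ a $ b | _ \<Rightarrow> 0)"

lemma block_diag_nth [simp]:
  "block_diag A B $ Inl i $ Inl j = A $ i $ j" "block_diag A B $ Inr a $ Inr b = B $ a $ b"
  "block_diag A B $ Inl i $ Inr b = 0" "block_diag A B $ Inr a $ Inl j = 0"
  by (simp_all add: block_diag_def)

lemma block_diag_mult: "block_diag A B ** block_diag A' B' = block_diag (A ** A') (B ** B')"
  by (simp add: vec_eq_Plus_iff matrix_matrix_mult_def sum_UNIV_Plus)

lemma transpose_block_diag: "transpose (block_diag A B) = block_diag (transpose A) (transpose B)"
  by (simp add: vec_eq_Plus_iff transpose_def)

lemma block_diag_mat: "block_diag (mat c) (mat c) = mat c"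
  by (simp add: vec_eq_Plus_iff mat_def)

lemma invertible_block_diag: "invertible A \<Longrightarrow> invertible B \<Longrightarrow> invertible (block_diag A B)"
  unfolding invertible_def by (metis block_diag_mult block_diag_mat)

lemma matrix_inv_block_diag:
  "invertible A \<Longrightarrow> invertible B \<Longrightarrow> matrix_inv (block_diag A B) = block_diag (matrix_inv A) (matrix_inv B)"
  by (rule matrix_inv_unique) (simp_all add: block_diag_mult matrix_inv_works block_diag_mat)

lemma scaleR_matrix_mult: "(c *\<^sub>R A) ** B = c *\<^sub>R (A ** (B :: real ^ 'k ^ 'n))"
  by (simp add: vec_eq_iff matrix_matrix_mult_def sum_distrib_left mult.assoc)

lemma matrix_mult_scaleR: "A ** (c *\<^sub>R B) = c *\<^sub>R (A ** (B :: real ^ 'k ^ 'n))"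
  by (simp add: vec_eq_iff matrix_matrix_mult_def sum_distrib_left mult.left_commute)

lemma transpose_scaleR: "transpose (c *\<^sub>R A) = c *\<^sub>R transpose (A :: real ^ 'k ^ 'n)"
  by (simp add: vec_eq_iff transpose_def)

lemma
  fixes A :: "real ^ 'n ^ 'n"
  assumes "invertible A" "c \<noteq> 0"
  shows invertible_scaleR: "invertible (c *\<^sub>R A)"
    and matrix_inv_scaleR: "matrix_inv (c *\<^sub>R A) = inverse c *\<^sub>R matrix_inv A"
proof -
  have *: "(c *\<^sub>R A) ** (inverse c *\<^sub>R matrix_inv A) = mat 1"
    "(inverse c *\<^sub>R matrix_inv A) ** (c *\<^sub>R A) = mat 1"
    using assms by (simp_all add: scaleR_matrix_mult matrix_mult_scaleR matrix_inv_works)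
  show "invertible (c *\<^sub>R A)" unfolding invertible_def using * by blast
  show "matrix_inv (c *\<^sub>R A) = inverse c *\<^sub>R matrix_inv A" using * by (rule matrix_inv_unique)
qed

text \<open>Dividing an orthonormal basis by sqrt c makes it orthonormal for the scaled form, with
  the same signs because c is positive.\<close>

lemma has_index_scaleR:
  fixes A :: "real ^ 'n::finite ^ 'n"
  assumes "has_index A k" "c > 0"
  shows "has_index (c *\<^sub>R A) k"
proof -
  obtain P :: "real ^ 'n ^ 'n" and e where P: "invertible P" "\<forall>i. e i = 1 \<or> e i = -1"
    "transpose P ** A ** P = (\<chi> i j. if i = j then e i else 0)" "card {i. e i = -1} = k"
    using assms(1) unfolding has_index_def by blast
  let ?P = "inverse (sqrt c) *\<^sub>R P"
  have "transpose ?P ** (c *\<^sub>R A) ** ?P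
      = (inverse (sqrt c) * (c * inverse (sqrt c))) *\<^sub>R (transpose P ** A ** P)"
    by (simp only: transpose_scaleR scaleR_matrix_mult matrix_mult_scaleR scaleR_scaleR mult.assoc)
  then have "transpose ?P ** (c *\<^sub>R A) ** ?P = transpose P ** A ** P"
    using assms(2) by (simp add: field_simps)
  moreover have "invertible ?P" using P(1) assms(2) by (intro invertible_scaleR) auto
  ultimately show ?thesis
    unfolding has_index_def using P by (intro exI[of _ ?P] exI[of _ e]) simp
qed

lemma card_Collect_Plus:
  "card {s :: 'a::finite + 'b::finite. R s} = card {i. R (Inl i)} + card {a. R (Inr a)}"
proof -
  have "{s. R s} = Inl ` {i. R (Inl i)} \<union> Inr ` {a. R (Inr a)}"
    by (auto simp: image_iff) (metis sum.exhaust)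
  then show ?thesis by (simp only:) (subst card_Un_disjoint, auto simp: card_image)
qed

text \<open>The union of orthonormal bases of the two summands is an orthonormal basis of the
  orthogonal sum, so the numbers of timelike vectors add.\<close>

lemma has_index_block_diag:
  fixes A :: "real ^ 'i::finite ^ 'i" and B :: "real ^ 'j::finite ^ 'j"
  assumes "has_index A k" "has_index B l"
  shows "has_index (block_diag A B) (k + l)"
proof -
  obtain P :: "real ^ 'i ^ 'i" and e where P: "invertible P" "\<forall>i. e i = 1 \<or> e i = -1"
    "transpose P ** A ** P = (\<chi> i j. if i = j then e i else 0)" "card {i. e i = -1} = k"
    using assms(1) unfolding has_index_def by blast
  obtain Q :: "real ^ 'j ^ 'j" and e' where Q: "invertible Q" "\<forall>i. e' i = 1 \<or> e' i = -1"
    "transpose Q ** B ** Q = (\<chi> i j. if i = j then e' i else 0)" "card {i. e' i = -1} = l"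
    using assms(2) unfolding has_index_def by blast
  let ?e = "case_sum e e'"
  have "transpose (block_diag P Q) ** block_diag A B ** block_diag P Q
      = (\<chi> s t. if s = t then ?e s else 0)"
    by (simp add: transpose_block_diag block_diag_mult P(3) Q(3) vec_eq_Plus_iff)
  moreover have "\<forall>s. ?e s = 1 \<or> ?e s = -1" using P(2) Q(2) by (auto split: sum.split)
  moreover have "card {s. ?e s = -1} = k + l" using P(4) Q(4) by (simp add: card_Collect_Plus)
  ultimately show ?thesis
    unfolding has_index_def using invertible_block_diag[OF P(1) Q(1)] by blast
qed

section \<open>Charts\<close>

lemma smooth_manifold_chart:
  assumes "smooth_manifold M" "c \<in> charts M"
  shows "open (chart_map M c ` chart_dom M c)" "openin (topology_of M) (chart_dom M c)"
    "homeomorphic_map (subtopology (topology_of M) (chart_dom M c))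
       (top_of_set (chart_map M c ` chart_dom M c)) (chart_map M c)"
  using assms by (auto simp: smooth_manifold_def)

lemma inj_on_chart_map:
  assumes "smooth_manifold M" "c \<in> charts M"
  shows "inj_on (chart_map M c) (chart_dom M c)"
  using homeomorphic_imp_injective_map[OF smooth_manifold_chart(3)[OF assms]]
    openin_subset[OF smooth_manifold_chart(2)[OF assms]]
  by (simp add: Int_absorb1)

lemma chart_inv_chart_map:
  assumes "smooth_manifold M" "c \<in> charts M" "p \<in> chart_dom M c"
  shows "chart_inv M c (chart_map M c p) = p"
  unfolding chart_inv_def using assms by (simp add: inj_on_chart_map)

text \<open>A chart is an open map onto its image, and that image is open in the coordinate space,
  so relatively open sets are open. Openness is needed to replace functions by others that agree
  with them on the overlap.\<close>

lemma open_chart_map_Int: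
  assumes "smooth_manifold M" "c \<in> charts M" "c' \<in> charts M"
  shows "open (chart_map M c ` (chart_dom M c \<inter> chart_dom M c'))"
proof -
  have "openin (subtopology (topology_of M) (chart_dom M c)) (chart_dom M c \<inter> chart_dom M c')"
    using smooth_manifold_chart(2)[OF assms(1)] assms(2,3)
    by (simp add: openin_Int_open openin_subtopology_Int2)
  then have "openin (top_of_set (chart_map M c ` chart_dom M c))
      (chart_map M c ` (chart_dom M c \<inter> chart_dom M c'))"
    using homeomorphic_imp_open_map[OF smooth_manifold_chart(3)[OF assms(1,2)]]
    by (simp add: open_map_def)
  then show ?thesis
    using smooth_manifold_chart(1)[OF assms(1,2)] openin_open_eq by blast
qed

text \<open>Symmetry of the metric and the formulas for its inverse hold only on chart domains; this
  is what permits them under a derivative.\<close>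

lemma coord_deriv_cong:
  assumes "smooth_manifold M" "c \<in> charts M" "p \<in> chart_dom M c"
    "\<And>q. q \<in> chart_dom M c \<Longrightarrow> u q = v q"
  shows "coord_deriv M c i u p = coord_deriv M c i v p"
  unfolding coord_deriv_def
  by (rule pd_cong[OF smooth_manifold_chart(1)[OF assms(1,2)]])
    (use assms in \<open>auto simp: chart_inv_chart_map\<close>)

lemma coord_deriv_const [simp]: "coord_deriv M c i (\<lambda>_. k) p = 0"
  by (simp add: coord_deriv_def pd_def)

lemma smooth_in_chart_const:
  "smooth_manifold M \<Longrightarrow> c \<in> charts M \<Longrightarrow> smooth_in_chart M c (\<lambda>_. k)"
  by (simp add: smooth_in_chart_def smooth_on_const smooth_manifold_chart)

lemma smooth_in_chart_mult:
  "smooth_manifold M \<Longrightarrow> c \<in> charts M \<Longrightarrow> smooth_in_chart M c u \<Longrightarrow> smooth_in_chart M c v \<Longrightarrow>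
    smooth_in_chart M c (\<lambda>p. u p * v p)"
  by (simp add: smooth_in_chart_def smooth_on_mult smooth_manifold_chart)

lemma smooth_in_chart_inverse:
  assumes "smooth_manifold M" "c \<in> charts M" "smooth_in_chart M c u" "\<And>p. p \<in> chart_dom M c \<Longrightarrow> u p > 0"
  shows "smooth_in_chart M c (\<lambda>p. inverse (u p))"
  unfolding smooth_in_chart_def
  by (rule smooth_on_inverse)
    (use assms in \<open>auto simp: smooth_in_chart_def smooth_manifold_chart chart_inv_chart_map\<close>)

section \<open>Product manifolds\<close>

lemma product_manifold_simps [simp]:
  "topology_of (product_manifold B F) = prod_topology (topology_of B) (topology_of F)"
  "charts (product_manifold B F) = charts B \<times> charts F"
  "chart_dom (product_manifold B F) (c, d) = chart_dom B c \<times> chart_dom F d"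
  "chart_map (product_manifold B F) (c, d) (p, q) = vec_join (chart_map B c p) (chart_map F d q)"
  by (simp_all add: product_manifold_def vec_join_def)

lemma chart_map_product_image:
  "chart_map (product_manifold B F) (c, d) ` (S \<times> T)
     = {z. vec_fst z \<in> chart_map B c ` S \<and> vec_snd z \<in> chart_map F d ` T}"
proof -
  have "z = vec_join x y" if "vec_fst z = x" "vec_snd z = y" for z x y
    using that vec_join_fst_snd by metis
  then show ?thesis by (force simp: image_iff)
qed

lemma open_vec_fst_snd:
  fixes S :: "(real ^ 'i::finite) set" and T :: "(real ^ 'j::finite) set"
  assumes "open S" "open T"
  shows "open {z. vec_fst z \<in> S \<and> vec_snd z \<in> T}"
proof -
  have "open (vec_fst -` S \<inter> vec_snd -` T :: (real ^ ('i + 'j)) set)"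
    using assms continuous_on_vec_fst continuous_on_vec_snd
    by (intro open_Int open_vimage) auto
  then show ?thesis by (simp add: vimage_def Int_def)
qed

lemma smooth_on_vec_fst:
  fixes T :: "(real ^ ('i::finite + 'j::finite)) set"
  assumes "open T" "vec_fst ` T \<subseteq> S" "smooth_on S u"
  shows "smooth_on T (\<lambda>z. u (vec_fst z))"
proof (rule smooth_on_compose[OF assms(1,2) _ assms(3)])
  fix b :: "real ^ 'i" assume "b \<in> Basis"
  then obtain i where "b = axis i 1" by (auto simp: Basis_vec_def)
  then show "smooth_on T (\<lambda>z. vec_fst z \<bullet> b)"
    using smooth_on_linear[OF assms(1) bounded_linear_vec_nth] by (simp add: inner_axis)
qed

lemma smooth_on_vec_snd:
  fixes T :: "(real ^ ('i::finite + 'j::finite)) set"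
  assumes "open T" "vec_snd ` T \<subseteq> S" "smooth_on S u"
  shows "smooth_on T (\<lambda>z. u (vec_snd z))"
proof (rule smooth_on_compose[OF assms(1,2) _ assms(3)])
  fix b :: "real ^ 'j" assume "b \<in> Basis"
  then obtain a where "b = axis a 1" by (auto simp: Basis_vec_def)
  then show "smooth_on T (\<lambda>z. vec_snd z \<bullet> b)"
    using smooth_on_linear[OF assms(1) bounded_linear_vec_nth] by (simp add: inner_axis)
qed

text \<open>An open set is the union of all basic sets inside it exactly when each of its points has
  a basic neighbourhood inside it. The pointwise form is the one that passes easily to
  products.\<close>

lemma second_countable_space_iff: "second_countable_space X \<longleftrightarrow> second_countable X"
proof
  assume "second_countable_space X"
  then obtain \<B> where \<B>: "countable \<B>" "\<forall>B\<in>\<B>. openin X B"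
    "\<And>U. openin X U \<Longrightarrow> \<exists>\<U>\<subseteq>\<B>. U = \<Union>\<U>" by (auto simp: second_countable_space_def)
  show "second_countable X" unfolding second_countable_def
  proof (intro exI conjI allI impI)
    fix U x assume "openin X U \<and> x \<in> U"
    then show "\<exists>V\<in>\<B>. x \<in> V \<and> V \<subseteq> U" using \<B>(3)[of U] by blast
  qed (use \<B> in auto)
next
  assume "second_countable X"
  then obtain \<B> where \<B>: "countable \<B>" "\<forall>B\<in>\<B>. openin X B"
    "\<And>U x. openin X U \<Longrightarrow> x \<in> U \<Longrightarrow> \<exists>V\<in>\<B>. x \<in> V \<and> V \<subseteq> U" by (auto simp: second_countable_def)
  show "second_countable_space X" unfolding second_countable_space_def
  proof (intro exI conjI allI impI)
    fix U assume "openin X U"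
    then show "{V\<in>\<B>. V \<subseteq> U} \<subseteq> \<B>" "U = \<Union>{V\<in>\<B>. V \<subseteq> U}" using \<B>(3)[of U] by blast+
  qed (use \<B> in auto)
qed

lemma second_countable_prod_topology:
  assumes "second_countable X" "second_countable Y"
  shows "second_countable (prod_topology X Y)"
proof -
  obtain \<B> where \<B>: "countable \<B>" "\<forall>B\<in>\<B>. openin X B"
    "\<And>U x. openin X U \<Longrightarrow> x \<in> U \<Longrightarrow> \<exists>V\<in>\<B>. x \<in> V \<and> V \<subseteq> U"
    using assms(1) by (auto simp: second_countable_def)
  obtain \<C> where \<C>: "countable \<C>" "\<forall>B\<in>\<C>. openin Y B"
    "\<And>U x. openin Y U \<Longrightarrow> x \<in> U \<Longrightarrow> \<exists>V\<in>\<C>. x \<in> V \<and> V \<subseteq> U"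
    using assms(2) by (auto simp: second_countable_def)
  show ?thesis unfolding second_countable_def
  proof (intro exI conjI allI impI)
    show "countable ((\<lambda>(V, W). V \<times> W) ` (\<B> \<times> \<C>))" using \<B>(1) \<C>(1) by simp
    show "\<forall>V\<in>(\<lambda>(V, W). V \<times> W) ` (\<B> \<times> \<C>). openin (prod_topology X Y) V"
      using \<B>(2) \<C>(2) by (auto simp: openin_prod_Times_iff)
    fix U z assume U: "openin (prod_topology X Y) U \<and> z \<in> U"
    obtain x y where z: "z = (x, y)" by force
    obtain V W where "openin X V" "openin Y W" "x \<in> V" "y \<in> W" "V \<times> W \<subseteq> U"
      using U z unfolding openin_prod_topology_alt by blast
    with \<B>(3)[of V x] \<C>(3)[of W y] obtain V' W' where
      "V' \<in> \<B>" "W' \<in> \<C>" "x \<in> V'" "y \<in> W'" "V' \<subseteq> V" "W' \<subseteq> W" by metis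
    then show "\<exists>V\<in>(\<lambda>(V, W). V \<times> W) ` (\<B> \<times> \<C>). z \<in> V \<and> V \<subseteq> U"
      using \<open>V \<times> W \<subseteq> U\<close> z by (intro bexI[of _ "V' \<times> W'"]) auto
  qed
qed

lemma homeomorphic_map_vec_join:
  fixes S :: "(real ^ 'i::finite) set" and T :: "(real ^ 'j::finite) set"
  shows "homeomorphic_map (top_of_set (S \<times> T)) (top_of_set {z. vec_fst z \<in> S \<and> vec_snd z \<in> T})
    (\<lambda>(x, y). vec_join x y)"
proof -
  have "homeomorphic_maps (top_of_set (S \<times> T)) (top_of_set {z. vec_fst z \<in> S \<and> vec_snd z \<in> T})
    (\<lambda>(x, y). vec_join x y) (\<lambda>z. (vec_fst z, vec_snd z))"
    unfolding homeomorphic_maps_def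
    by (auto simp: case_prod_unfold intro!: continuous_on_vec_join continuous_on_Pair
        continuous_on_vec_fst continuous_on_vec_snd continuous_on_fst continuous_on_snd continuous_on_id)
  then show ?thesis using homeomorphic_maps_map by blast
qed

context
  fixes B :: "('p, 'c, 'i::finite) manifold" and F :: "('q, 'd, 'j::finite) manifold"
  assumes B: "smooth_manifold B" and F: "smooth_manifold F"
begin

text \<open>\<open>inv_into\<close> is a choice, determined only where the product chart is
  injective and only on its image; hence the membership hypotheses on x and y.\<close>

lemma chart_inv_product:
  assumes "c \<in> charts B" "d \<in> charts F"
    and "x \<in> chart_map B c ` chart_dom B c" "y \<in> chart_map F d ` chart_dom F d"
  shows "chart_inv (product_manifold B F) (c, d) (vec_join x y) = (chart_inv B c x, chart_inv F d y)"
proof -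
  obtain p q where p: "p \<in> chart_dom B c" "x = chart_map B c p"
    and q: "q \<in> chart_dom F d" "y = chart_map F d q" using assms by auto
  have "inj_on (chart_map (product_manifold B F) (c, d)) (chart_dom B c \<times> chart_dom F d)"
  proof (rule inj_onI)
    fix a b assume ab: "a \<in> chart_dom B c \<times> chart_dom F d" "b \<in> chart_dom B c \<times> chart_dom F d"
      "chart_map (product_manifold B F) (c, d) a = chart_map (product_manifold B F) (c, d) b"
    then have "vec_join (chart_map B c (fst a)) (chart_map F d (snd a))
        = vec_join (chart_map B c (fst b)) (chart_map F d (snd b))" by auto
    then have "chart_map B c (fst a) = chart_map B c (fst b)" "chart_map F d (snd a) = chart_map F d (snd b)"
      by (metis vec_fst_join, metis vec_snd_join)
    then show "a = b"
      using ab inj_onD[OF inj_on_chart_map[OF B assms(1)], of "fst a" "fst b"]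
        inj_onD[OF inj_on_chart_map[OF F assms(2)], of "snd a" "snd b"]
      by (simp add: mem_Times_iff prod_eq_iff)
  qed
  from inv_into_f_f[OF this, of "(p, q)"] show ?thesis
    using assms p q by (simp add: chart_inv_def[of "product_manifold B F"] chart_inv_chart_map B F)
qed

text \<open>A step along one coordinate axis of the product moves only one of the two factors. The
  splitting of \<open>chart_inv\<close> is known on the chart image alone, and the line stays there
  for small t because the image is open.\<close>

lemma coord_deriv_product:
  assumes "c \<in> charts B" "d \<in> charts F" "p \<in> chart_dom B c" "q \<in> chart_dom F d"
  shows coord_deriv_product_Inl:
      "coord_deriv (product_manifold B F) (c, d) (Inl i) u (p, q) = coord_deriv B c i (\<lambda>p. u (p, q)) p"
    and coord_deriv_product_Inr:
      "coord_deriv (product_manifold B F) (c, d) (Inr a) u (p, q) = coord_deriv F d a (\<lambda>q. u (p, q)) q"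
proof -
  note in_B = eventually_line_in_open[OF smooth_manifold_chart(1)[OF B assms(1)] imageI[OF assms(3)]]
  note in_F = eventually_line_in_open[OF smooth_manifold_chart(1)[OF F assms(2)] imageI[OF assms(4)]]
  show "coord_deriv (product_manifold B F) (c, d) (Inl i) u (p, q) = coord_deriv B c i (\<lambda>p. u (p, q)) p"
    unfolding coord_deriv_def pd_def
    by (intro deriv_cong_ev eventually_mono[OF in_B[of "axis i 1"]])
      (use assms in \<open>simp_all add: vec_join_axis chart_inv_product chart_inv_chart_map F\<close>)
  show "coord_deriv (product_manifold B F) (c, d) (Inr a) u (p, q) = coord_deriv F d a (\<lambda>q. u (p, q)) q"
    unfolding coord_deriv_def pd_def
    by (intro deriv_cong_ev eventually_mono[OF in_F[of "axis a 1"]])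
      (use assms in \<open>simp_all add: vec_join_axis chart_inv_product chart_inv_chart_map B\<close>)
qed

text \<open>S and T are arbitrary open parts of the chart images because two cases occur: the full
  images, for smoothness of functions, and the images of overlaps, for transition maps.\<close>

lemma smooth_on_product_chart:
  assumes "c \<in> charts B" "d \<in> charts F" "open S" "open T"
    and "S \<subseteq> chart_map B c ` chart_dom B c" "T \<subseteq> chart_map F d ` chart_dom F d"
  shows smooth_on_product_fst: "smooth_on S (\<lambda>x. u (chart_inv B c x)) \<Longrightarrow>
      smooth_on {z. vec_fst z \<in> S \<and> vec_snd z \<in> T}
        (\<lambda>z. u (fst (chart_inv (product_manifold B F) (c, d) z)))"
    and smooth_on_product_snd: "smooth_on T (\<lambda>x. v (chart_inv F d x)) \<Longrightarrow>
      smooth_on {z. vec_fst z \<in> S \<and> vec_snd z \<in> T}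
        (\<lambda>z. v (snd (chart_inv (product_manifold B F) (c, d) z)))"
proof -
  let ?W = "{z. vec_fst z \<in> S \<and> vec_snd z \<in> T}"
  have W: "open ?W" using assms(3,4) by (rule open_vec_fst_snd)
  have inv: "chart_inv (product_manifold B F) (c, d) z
      = (chart_inv B c (vec_fst z), chart_inv F d (vec_snd z))" if "z \<in> ?W" for z
    using chart_inv_product[OF assms(1,2), of "vec_fst z" "vec_snd z"] assms(5,6) that by auto
  show "smooth_on ?W (\<lambda>z. u (fst (chart_inv (product_manifold B F) (c, d) z)))"
    if "smooth_on S (\<lambda>x. u (chart_inv B c x))"
    by (rule smooth_on_cong[OF W _ smooth_on_vec_fst[OF W _ that]]) (auto simp: inv)
  show "smooth_on ?W (\<lambda>z. v (snd (chart_inv (product_manifold B F) (c, d) z)))"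
    if "smooth_on T (\<lambda>x. v (chart_inv F d x))"
    by (rule smooth_on_cong[OF W _ smooth_on_vec_snd[OF W _ that]]) (auto simp: inv)
qed

lemma smooth_in_chart_product:
  assumes "c \<in> charts B" "d \<in> charts F"
  shows smooth_in_chart_fst:
      "smooth_in_chart B c u \<Longrightarrow> smooth_in_chart (product_manifold B F) (c, d) (\<lambda>z. u (fst z))"
    and smooth_in_chart_snd:
      "smooth_in_chart F d v \<Longrightarrow> smooth_in_chart (product_manifold B F) (c, d) (\<lambda>z. v (snd z))"
  unfolding smooth_in_chart_def product_manifold_simps chart_map_product_image
  by (rule smooth_on_product_fst smooth_on_product_snd; use assms in \<open>simp add: smooth_manifold_chart B F\<close>)+

lemma smooth_manifold_product: "smooth_manifold (product_manifold B F)"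
  unfolding smooth_manifold_def
proof (intro conjI ballI allI)
  let ?M = "product_manifold B F"
  show "Hausdorff_space (topology_of ?M)"
    using B F by (simp add: smooth_manifold_def Hausdorff_space_prod_topology)
  show "second_countable_space (topology_of ?M)"
    using B F by (simp add: smooth_manifold_def second_countable_space_iff second_countable_prod_topology)
  have "(\<Union>e\<in>charts ?M. chart_dom ?M e) = (\<Union>c\<in>charts B. chart_dom B c) \<times> (\<Union>d\<in>charts F. chart_dom F d)"
    by auto
  then show "(\<Union>e\<in>charts ?M. chart_dom ?M e) = topspace (topology_of ?M)"
    using B F by (simp add: smooth_manifold_def)
  fix e assume "e \<in> charts ?M"
  then obtain c d where e: "e = (c, d)" "c \<in> charts B" "d \<in> charts F" by auto
  note cB = smooth_manifold_chart[OF B e(2)] and dF = smooth_manifold_chart[OF F e(3)]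
  show "openin (topology_of ?M) (chart_dom ?M e)"
    using cB dF by (simp add: e openin_prod_Times_iff)
  show "open (chart_map ?M e ` chart_dom ?M e)"
    using cB dF by (simp add: e chart_map_product_image open_vec_fst_snd)
  show "homeomorphic_map (subtopology (topology_of ?M) (chart_dom ?M e))
      (top_of_set (chart_map ?M e ` chart_dom ?M e)) (chart_map ?M e)"
  proof -
    \<comment> \<open>The product chart factors through pairs: the product of the two charts,
      followed by the regrouping \<open>vec_join\<close>.\<close>
    have "homeomorphic_map (subtopology (topology_of ?M) (chart_dom ?M e))
        (top_of_set (chart_map B c ` chart_dom B c \<times> chart_map F d ` chart_dom F d))
        (\<lambda>(p, q). (chart_map B c p, chart_map F d q))"
      using cB(3) dF(3) homeomorphic_maps_prod[of "subtopology (topology_of B) (chart_dom B c)"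
          "subtopology (topology_of F) (chart_dom F d)"
          "top_of_set (chart_map B c ` chart_dom B c)" "top_of_set (chart_map F d ` chart_dom F d)"
          "chart_map B c" "chart_map F d"]
      unfolding homeomorphic_map_maps by (simp add: e subtopology_Times) blast
    from homeomorphic_map_compose[OF this homeomorphic_map_vec_join]
    have "homeomorphic_map (subtopology (topology_of ?M) (chart_dom ?M e))
      (top_of_set (chart_map ?M e ` chart_dom ?M e))
      ((\<lambda>(x, y). vec_join x y) \<circ> (\<lambda>(p, q). (chart_map B c p, chart_map F d q)))"
      by (simp add: e chart_map_product_image)
    moreover have "(\<lambda>(x, y). vec_join x y) \<circ> (\<lambda>(p, q). (chart_map B c p, chart_map F d q)) = chart_map ?M e"
      by (auto simp: e)
    ultimately show ?thesis by simp
  qed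
  fix e' s assume "e' \<in> charts ?M"
  then obtain c' d' where e': "e' = (c', d')" "c' \<in> charts B" "d' \<in> charts F" by auto
  let ?S = "chart_map B c ` (chart_dom B c \<inter> chart_dom B c')"
  let ?T = "chart_map F d ` (chart_dom F d \<inter> chart_dom F d')"
  have trans: "smooth_on ?S (\<lambda>x. chart_map B c' (chart_inv B c x) $ i)"
    "smooth_on ?T (\<lambda>x. chart_map F d' (chart_inv F d x) $ a)" for i a
    using B F e e' by (auto simp: smooth_manifold_def)
  note ST = e(2,3) open_chart_map_Int[OF B e(2) e'(2)] open_chart_map_Int[OF F e(3) e'(3)]
    image_mono[OF Int_lower1] image_mono[OF Int_lower1]
  have "chart_dom ?M e \<inter> chart_dom ?M e' = (chart_dom B c \<inter> chart_dom B c') \<times> (chart_dom F d \<inter> chart_dom F d')"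
    by (auto simp: e e')
  moreover have cm: "chart_map ?M e' z = vec_join (chart_map B c' (fst z)) (chart_map F d' (snd z))" for z
    by (cases z) (simp add: e')
  \<comment> \<open>A component of the transition map of the product is a component of the
    transition map of a single factor, chosen by the side of s.\<close>
  ultimately show "smooth_on (chart_map ?M e ` (chart_dom ?M e \<inter> chart_dom ?M e'))
      (\<lambda>x. chart_map ?M e' (chart_inv ?M e x) $ s)"
    using smooth_on_product_fst[OF ST trans(1)] smooth_on_product_snd[OF ST trans(2)]
    by (cases s) (simp_all add: cm e(1) chart_map_product_image del: product_manifold_simps(4))
qed

end

section \<open>Conformal and warped product metrics\<close>

lemma sum_delta_mult:
  "(\<Sum>l\<in>UNIV. (if k = l then u l else 0) * v l) = u k * (v k :: real)" for k :: "'n::finite"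
  by (simp add: if_distrib[where f = "\<lambda>x. x * _"] cong: if_cong)

lemma euclidean_manifold_simps [simp]:
  "topology_of euclidean_manifold = euclidean" "charts euclidean_manifold = UNIV"
  "chart_dom euclidean_manifold c = UNIV" "chart_map euclidean_manifold c = (\<lambda>x. x)"
  "chart_inv euclidean_manifold c = (\<lambda>x. x)"
proof -
  have "inv (\<lambda>x. x) = (\<lambda>x :: real ^ 'n. x)" by (rule inv_unique_comp) (auto simp: o_def)
  then show "chart_inv euclidean_manifold c = (\<lambda>x :: real ^ 'n::finite. x)"
    by (simp add: chart_inv_def euclidean_manifold_def)
qed (simp_all add: euclidean_manifold_def)

lemma second_countable_euclidean: "second_countable (euclidean :: 'a::second_countable_topology topology)"
proof -
  obtain \<B> :: "'a set set" where "countable \<B>" "topological_basis \<B>"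
    using ex_countable_basis by blast
  then show ?thesis
    unfolding second_countable_def open_openin[symmetric]
    by (metis topological_basisE topological_basis_open)
qed

lemma smooth_manifold_euclidean: "smooth_manifold (euclidean_manifold :: (real ^ 'n::finite, unit, 'n) manifold)"
  unfolding smooth_manifold_def second_countable_space_iff
  by (auto simp: Hausdorff_space_euclidean second_countable_euclidean homeomorphic_map_id[unfolded id_def]
      intro: smooth_on_linear bounded_linear_vec_nth)

lemma semi_riemannian_manifold_pseudo_euclidean:
  fixes \<epsilon> :: "'n::finite \<Rightarrow> real"
  assumes "\<And>i. \<epsilon> i = 1 \<or> \<epsilon> i = -1"
  shows "semi_riemannian_manifold euclidean_manifold (pseudo_euclidean_metric \<epsilon>)"
proof -
  let ?g = "\<chi> i j. if i = j then \<epsilon> i else 0"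
  have [simp]: "\<epsilon> i * \<epsilon> i = 1" for i using assms[of i] by auto
  have "?g ** ?g = mat 1"
    by (simp add: vec_eq_iff matrix_matrix_mult_def mat_def if_distrib[where f = "\<lambda>x. x * _"] cong: if_cong)
  then have inv: "invertible ?g" by (auto simp: invertible_def)
  have sym: "transpose ?g = ?g" by (auto simp: vec_eq_iff transpose_def)
  have index: "has_index ?g (card {i. \<epsilon> i = -1})"
    \<comment> \<open>The standard basis is already orthonormal, so the identity matrix serves as
      the basis change.\<close>
    unfolding has_index_def
    by (intro exI[of _ "mat 1"] exI[of _ \<epsilon>]) (use assms in \<open>auto simp: invertible_def\<close>)
  have pd_nth: "pd (axis i 1) (\<lambda>x :: real ^ 'n. x $ k) x = (if i = k then 1 else 0)" for i k x
    using pd_has_derivative[OF bounded_linear_imp_has_derivative[OF bounded_linear_vec_nth], of "axis i 1" k x]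
    by (simp add: axis_def)
  have trans: "?g $ i $ j = (\<Sum>k\<in>UNIV. \<Sum>l\<in>UNIV. pd (axis i 1) (\<lambda>x. x $ k) p *
      pd (axis j 1) (\<lambda>x. x $ l) p * ?g $ k $ l)" for i j p
    by (simp only: pd_nth mult.assoc sum_distrib_left[symmetric] sum_delta_mult mult_1_left)
  show ?thesis
    unfolding semi_riemannian_manifold_def semi_riemannian_metric_def
    using inv sym index smooth_on_const[of UNIV "?g $ _ $ _"] trans
    by (simp only: pseudo_euclidean_metric_def smooth_manifold_euclidean smooth_in_chart_def
        coord_deriv_def euclidean_manifold_simps image_ident open_UNIV simp_thms UNIV_I) blast
qed

lemma semi_riemannian_metricD:
  assumes "semi_riemannian_metric M g" "c \<in> charts M"
  shows "smooth_in_chart M c (\<lambda>p. g c p $ i $ j)"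
    and "p \<in> chart_dom M c \<Longrightarrow> transpose (g c p) = g c p"
    and "p \<in> chart_dom M c \<Longrightarrow> invertible (g c p)"
    and "c' \<in> charts M \<Longrightarrow> p \<in> chart_dom M c \<Longrightarrow> p \<in> chart_dom M c' \<Longrightarrow> g c p $ i $ j =
          (\<Sum>k\<in>UNIV. \<Sum>l\<in>UNIV. coord_deriv M c i (\<lambda>q. chart_map M c' q $ k) p *
             coord_deriv M c j (\<lambda>q. chart_map M c' q $ l) p * g c' p $ k $ l)"
  using assms unfolding semi_riemannian_metric_def by blast+

lemma semi_riemannian_metric_index:
  assumes "semi_riemannian_metric M g"
  obtains \<nu> where "\<And>c p. c \<in> charts M \<Longrightarrow> p \<in> chart_dom M c \<Longrightarrow> has_index (g c p) \<nu>"
  using assms unfolding semi_riemannian_metric_def by blast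

text \<open>The transformation law is linear in the components and the factor is a function on the
  manifold, so the factor passes through it. Being positive, it also preserves the index.\<close>

lemma semi_riemannian_manifold_conformal:
  assumes "semi_riemannian_manifold M g" "smooth_function M u"
    and pos: "\<And>c p. c \<in> charts M \<Longrightarrow> p \<in> chart_dom M c \<Longrightarrow> u p > 0"
  shows "semi_riemannian_manifold M (conformal_metric u g)"
proof -
  have M: "smooth_manifold M" and g: "semi_riemannian_metric M g"
    using assms(1) by (auto simp: semi_riemannian_manifold_def)
  have u: "smooth_in_chart M c u" if "c \<in> charts M" for c
    using assms(2) that by (simp add: smooth_function_def)
  obtain \<nu> where \<nu>: "\<And>c p. c \<in> charts M \<Longrightarrow> p \<in> chart_dom M c \<Longrightarrow> has_index (g c p) \<nu>"
    using semi_riemannian_metric_index[OF g] by blast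
  have "semi_riemannian_metric M (conformal_metric u g)"
    unfolding semi_riemannian_metric_def
  proof (intro conjI ballI allI exI[of _ \<nu>])
    fix c i j assume c: "c \<in> charts M"
    have "smooth_in_chart M c (\<lambda>p. inverse (u p * u p) * g c p $ i $ j)"
      using c M by (intro smooth_in_chart_mult smooth_in_chart_inverse u semi_riemannian_metricD[OF g])
        (auto simp: pos)
    then show "smooth_in_chart M c (\<lambda>p. conformal_metric u g c p $ i $ j)"
      by (simp add: conformal_metric_def power2_eq_square divide_inverse)
  next
    fix c p assume cp: "c \<in> charts M" "p \<in> chart_dom M c"
    show "transpose (conformal_metric u g c p) = conformal_metric u g c p"
      using semi_riemannian_metricD(2)[OF g cp] by (simp add: conformal_metric_def transpose_scaleR)
    show "invertible (conformal_metric u g c p)"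
      using semi_riemannian_metricD(3)[OF g cp] pos[OF cp]
      by (simp add: conformal_metric_def invertible_scaleR)
    show "has_index (conformal_metric u g c p) \<nu>"
      using \<nu>[OF cp] pos[OF cp] by (simp add: conformal_metric_def has_index_scaleR)
  next
    fix c c' p i j assume "c \<in> charts M" "c' \<in> charts M" "p \<in> chart_dom M c \<inter> chart_dom M c'"
    then show "conformal_metric u g c p $ i $ j =
          (\<Sum>k\<in>UNIV. \<Sum>l\<in>UNIV. coord_deriv M c i (\<lambda>q. chart_map M c' q $ k) p *
             coord_deriv M c j (\<lambda>q. chart_map M c' q $ l) p * conformal_metric u g c' p $ k $ l)"
      using semi_riemannian_metricD(4)[OF g, of c c' p i j]
      by (simp add: conformal_metric_def sum_divide_distrib)
  qed
  then show ?thesis using M by (simp add: semi_riemannian_manifold_def)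
qed

lemma warped_product_metric_block_diag:
  "warped_product_metric gB f gF (c, d) (p, q) = block_diag (gB c p) ((f p)\<^sup>2 *\<^sub>R gF d q)"
  by (simp add: vec_eq_Plus_iff warped_product_metric_def)

text \<open>In block form all requirements can be checked on the diagonal blocks: a change of
  product charts does not mix base and fibre coordinates, and the index is the sum of the two
  indices.\<close>

lemma semi_riemannian_manifold_warped_product:
  assumes "semi_riemannian_manifold B gB" "semi_riemannian_manifold F gF" "smooth_function B f"
    and pos: "\<And>c p. c \<in> charts B \<Longrightarrow> p \<in> chart_dom B c \<Longrightarrow> f p > 0"
  shows "semi_riemannian_manifold (product_manifold B F) (warped_product_metric gB f gF)"
proof -
  have B: "smooth_manifold B" and gB: "semi_riemannian_metric B gB"
    and F: "smooth_manifold F" and gF: "semi_riemannian_metric F gF"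
    using assms(1,2) by (auto simp: semi_riemannian_manifold_def)
  note M = smooth_manifold_product[OF B F]
  let ?M = "product_manifold B F" and ?g = "warped_product_metric gB f gF"
  obtain \<nu> where \<nu>: "\<And>c p. c \<in> charts B \<Longrightarrow> p \<in> chart_dom B c \<Longrightarrow> has_index (gB c p) \<nu>"
    using semi_riemannian_metric_index[OF gB] by blast
  obtain \<mu> where \<mu>: "\<And>c p. c \<in> charts F \<Longrightarrow> p \<in> chart_dom F c \<Longrightarrow> has_index (gF c p) \<mu>"
    using semi_riemannian_metric_index[OF gF] by blast
  have "semi_riemannian_metric ?M ?g"
    unfolding semi_riemannian_metric_def
  proof (intro conjI ballI allI exI[of _ "\<nu> + \<mu>"])
    fix e s t assume e: "e \<in> charts ?M"
    then obtain c d where cd: "e = (c, d)" "c \<in> charts B" "d \<in> charts F" by auto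
    have f: "smooth_in_chart ?M (c, d) (\<lambda>z. f (fst z))"
      using assms(3) cd by (intro smooth_in_chart_fst B F) (auto simp: smooth_function_def)
    have g: "smooth_in_chart ?M (c, d) (\<lambda>z. gB c (fst z) $ i $ j)"
      "smooth_in_chart ?M (c, d) (\<lambda>z. gF d (snd z) $ a $ b)" for i j a b
      using cd by (auto intro!: smooth_in_chart_fst[where u = "\<lambda>p. gB c p $ i $ j"]
          smooth_in_chart_snd[where v = "\<lambda>q. gF d q $ a $ b"]
          semi_riemannian_metricD(1)[OF gB] semi_riemannian_metricD(1)[OF gF] B F)
    have fg: "smooth_in_chart ?M (c, d) (\<lambda>z. f (fst z) * f (fst z) * gF d (snd z) $ a $ b)" for a b
      using cd by (intro smooth_in_chart_mult[OF M] f g) auto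
    have const: "smooth_in_chart ?M (c, d) (\<lambda>_. 0)"
      using cd by (intro smooth_in_chart_const[OF M]) auto
    have "?g e = (\<lambda>z. block_diag (gB c (fst z)) ((f (fst z))\<^sup>2 *\<^sub>R gF d (snd z)))"
      by (auto simp: cd warped_product_metric_block_diag)
    then show "smooth_in_chart ?M e (\<lambda>z. ?g e z $ s $ t)"
      using f g fg const cd by (cases s; cases t) (auto simp: power2_eq_square)
  next
    fix e z assume "e \<in> charts ?M" "z \<in> chart_dom ?M e"
    then obtain c d p q where cd: "e = (c, d)" "z = (p, q)"
      and B': "c \<in> charts B" "p \<in> chart_dom B c" and F': "d \<in> charts F" "q \<in> chart_dom F d" by auto
    have f: "f p > 0" using pos B' by blast
    note gB' = semi_riemannian_metricD[OF gB B'(1)] and gF' = semi_riemannian_metricD[OF gF F'(1)]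
    show "transpose (?g e z) = ?g e z"
      using gB'(2) gF'(2) B' F'
      by (simp add: cd warped_product_metric_block_diag transpose_block_diag transpose_scaleR)
    show "invertible (?g e z)"
      using gB'(3) gF'(3) B' F' f
      by (simp add: cd warped_product_metric_block_diag invertible_block_diag invertible_scaleR)
    show "has_index (?g e z) (\<nu> + \<mu>)"
      using \<nu>[OF B'] \<mu>[OF F'] f
      by (simp add: cd warped_product_metric_block_diag has_index_block_diag has_index_scaleR)
  next
    fix e e' z s t
    assume "e \<in> charts ?M" "e' \<in> charts ?M" "z \<in> chart_dom ?M e \<inter> chart_dom ?M e'"
    then obtain c d c' d' p q where cd: "e = (c, d)" "e' = (c', d')" "z = (p, q)"
      and B': "c \<in> charts B" "c' \<in> charts B" "p \<in> chart_dom B c" "p \<in> chart_dom B c'"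
      and F': "d \<in> charts F" "d' \<in> charts F" "q \<in> chart_dom F d" "q \<in> chart_dom F d'" by auto
    note gB' = semi_riemannian_metricD(4)[OF gB B'] and gF' = semi_riemannian_metricD(4)[OF gF F']
    note dM = coord_deriv_product[OF B F B'(1) F'(1) B'(3) F'(3)]
    show "?g e z $ s $ t = (\<Sum>k\<in>UNIV. \<Sum>l\<in>UNIV. coord_deriv ?M e s (\<lambda>w. chart_map ?M e' w $ k) z *
             coord_deriv ?M e t (\<lambda>w. chart_map ?M e' w $ l) z * ?g e' z $ k $ l)"
      by (cases s; cases t)
        (simp_all add: cd warped_product_metric_block_diag sum_UNIV_Plus dM gB' gF'
          sum_distrib_left mult.left_commute)
  qed
  then show ?thesis using M by (simp add: semi_riemannian_manifold_def)
qed

section \<open>Curvature of the warped product\<close>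

lemma coord_deriv_cmult:
  assumes "smooth_manifold M" "c \<in> charts M" "p \<in> chart_dom M c" "smooth_in_chart M c u"
  shows "coord_deriv M c i (\<lambda>p. k * u p) p = k * coord_deriv M c i u p"
proof -
  have "(\<lambda>x. u (chart_inv M c x)) differentiable (at (chart_map M c p))"
    using assms by (auto simp: smooth_in_chart_def intro: smooth_on_differentiable)
  then obtain D where "((\<lambda>x. u (chart_inv M c x)) has_derivative D) (at (chart_map M c p))"
    by (auto simp: differentiable_def)
  note pd_has_derivative[OF this] pd_has_derivative[OF has_derivative_mult_right[OF this, of k]]
  then show ?thesis by (simp add: coord_deriv_def)
qed

text \<open>The traces \<open>\<Sum>r. \<Gamma> r r s\<close> are isolated because they have a
  simple closed form; only the last term then needs a genuine double contraction.\<close>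

lemma ricci_contracted:
  "ricci M g c j k p =
     (\<Sum>r\<in>UNIV. coord_deriv M c r (christoffel M g c r j k) p)
     - (\<Sum>r\<in>UNIV. coord_deriv M c j (christoffel M g c r r k) p)
     + (\<Sum>s\<in>UNIV. (\<Sum>r\<in>UNIV. christoffel M g c r r s p) * christoffel M g c s j k p)
     - (\<Sum>r\<in>UNIV. \<Sum>s\<in>UNIV. christoffel M g c r j s p * christoffel M g c s r k p)"
proof -
  have "(\<Sum>r\<in>UNIV. \<Sum>s\<in>UNIV. christoffel M g c r r s p * christoffel M g c s j k p)
      = (\<Sum>s\<in>UNIV. (\<Sum>r\<in>UNIV. christoffel M g c r r s p) * christoffel M g c s j k p)"
    by (subst sum.swap) (simp add: sum_distrib_right)
  then show ?thesis
    unfolding ricci_def riemann_def by (simp add: sum.distrib sum_subtractf)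
qed

lemma christoffel_commute:
  assumes "smooth_manifold M" "semi_riemannian_metric M g" "c \<in> charts M" "p \<in> chart_dom M c"
  shows "christoffel M g c k i j p = christoffel M g c k j i p"
proof -
  have "g c q $ i $ j = g c q $ j $ i" if "q \<in> chart_dom M c" for q
  proof -
    have "transpose (g c q) $ j $ i = g c q $ j $ i"
      using semi_riemannian_metricD(2)[OF assms(2,3) that] by simp
    then show ?thesis by (simp add: transpose_def)
  qed
  then have "coord_deriv M c l (\<lambda>q. g c q $ i $ j) p = coord_deriv M c l (\<lambda>q. g c q $ j $ i) p" for l
    by (rule coord_deriv_cong[OF assms(1,3,4)])
  then show ?thesis by (simp add: christoffel_def add.commute)
qed

section \<open>Warped products whose conformal and warping factors depend on a null
  coordinate\<close>

locale null_warped_product =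
  fixes \<epsilon> \<alpha> :: "'n::finite \<Rightarrow> real" and \<phi> f :: "real \<Rightarrow> real"
    and F :: "('q, 'd, 'm::finite) manifold" and gF :: "('q, 'd, 'm) tensor2"
  assumes signs: "\<And>i. \<epsilon> i = 1 \<or> \<epsilon> i = -1"
    and null: "(\<Sum>i\<in>UNIV. \<epsilon> i * (\<alpha> i)\<^sup>2) = 0"
    and smooth_\<phi>: "smooth_on UNIV \<phi>" and \<phi>_pos: "\<And>t. \<phi> t > 0"
    and smooth_f: "smooth_on UNIV f" and f_pos: "\<And>t. f t > 0"
    and fibre: "semi_riemannian_manifold F gF"
begin

definition \<xi> :: "real ^ 'n \<Rightarrow> real" where
  "\<xi> x = (\<Sum>i\<in>UNIV. \<alpha> i * x $ i)"

abbreviation M :: "((real ^ 'n) \<times> 'q, unit \<times> 'd, 'n + 'm) manifold" where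
  "M \<equiv> product_manifold euclidean_manifold F"

abbreviation g :: "((real ^ 'n) \<times> 'q, unit \<times> 'd, 'n + 'm) tensor2" where
  "g \<equiv> warped_product_metric (conformal_metric (\<lambda>x. \<phi> (\<xi> x)) (pseudo_euclidean_metric \<epsilon>))
     (\<lambda>x. f (\<xi> x)) gF"

text \<open>\<open>\<psi>\<close> and \<open>\<rho>\<close> are the logarithmic derivatives of
  \<phi> and f. Every nonzero Christoffel symbol outside the pure fibre ones is
  \<open>\<psi>\<close>, \<open>\<rho>\<close> or \<open>\<omega>\<close> at \<xi>, times a
  coefficient that is constant along the base.\<close>

definition \<psi> :: "real \<Rightarrow> real" where "\<psi> t = deriv \<phi> t / \<phi> t"

definition \<rho> :: "real \<Rightarrow> real" where "\<rho> t = deriv f t / f t"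

definition \<omega> :: "real \<Rightarrow> real" where "\<omega> t = (\<phi> t)\<^sup>2 * f t * deriv f t"

text \<open>This is the bracket in the classical Christoffel symbols of the conformally flat metric
  \<open>\<phi>\<^sup>-\<^sup>2 g\<close>, after extraction of \<open>- \<phi>' / \<phi>\<close>:
  the i-th partial derivative of \<phi> along \<xi> is \<open>\<alpha> i * \<phi>'\<close>.\<close>

definition \<kappa> :: "'n \<Rightarrow> 'n \<Rightarrow> 'n \<Rightarrow> real" where
  "\<kappa> k i j = (if k = j then \<alpha> i else 0) + (if k = i then \<alpha> j else 0) - (if i = j then \<epsilon> i * \<epsilon> k * \<alpha> k else 0)"

lemma \<xi>_linear: "bounded_linear \<xi>"
  unfolding \<xi>_def by (intro bounded_linear_sum bounded_linear_const_mult bounded_linear_vec_nth)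

lemma \<xi>_axis: "\<xi> (axis i 1) = \<alpha> i"
  by (simp add: \<xi>_def axis_def if_distrib cong: if_cong)

lemma smooth_along_\<xi>: "smooth_on UNIV w \<Longrightarrow> smooth_on UNIV (\<lambda>x. w (\<xi> x))"
  by (rule smooth_on_compose_real[where T = UNIV]) (auto intro: smooth_on_linear \<xi>_linear)

lemma DERIVs:
  "(\<phi> has_real_derivative deriv \<phi> t) (at t)" "(f has_real_derivative deriv f t) (at t)"
  "(deriv \<phi> has_real_derivative deriv (deriv \<phi>) t) (at t)"
  "(deriv f has_real_derivative deriv (deriv f) t) (at t)"
  using smooth_\<phi> smooth_f by (auto intro: smooth_on_real_DERIV smooth_on_deriv)

text \<open>The square is kept separate because it cancels against the quadratic Christoffel terms
  of the Ricci tensor, leaving \<open>\<phi>'' / \<phi>\<close>. The next lemma has its form for the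
  same reason.\<close>

lemma DERIV_\<psi>: "(\<psi> has_real_derivative deriv (deriv \<phi>) t / \<phi> t - (\<psi> t)\<^sup>2) (at t)"
  unfolding \<psi>_def using \<phi>_pos[of t]
  by (auto intro!: derivative_eq_intros DERIVs simp: field_simps power2_eq_square)

lemma DERIV_\<rho>: "(\<rho> has_real_derivative deriv (deriv f) t / f t - (\<rho> t)\<^sup>2) (at t)"
  unfolding \<rho>_def using f_pos[of t]
  by (auto intro!: derivative_eq_intros DERIVs simp: field_simps power2_eq_square)

text \<open>Only existence of the derivative matters: in the Ricci tensor its value is multiplied by
  the null sum.\<close>

lemma DERIV_\<omega>: "(\<omega> has_real_derivative deriv \<omega> t) (at t)"
proof -
  have "\<exists>D. (\<omega> has_real_derivative D) (at t)"
    unfolding \<omega>_def by (rule exI) (auto intro!: derivative_eq_intros DERIVs)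
  then show ?thesis using DERIV_imp_deriv by fastforce
qed

lemma smooth_manifold_fibre: "smooth_manifold F" and metric_fibre: "semi_riemannian_metric F gF"
  using fibre by (auto simp: semi_riemannian_manifold_def)

lemma semi_riemannian_M: "semi_riemannian_manifold M g"
  using signs \<phi>_pos f_pos smooth_along_\<xi>[OF smooth_\<phi>] smooth_along_\<xi>[OF smooth_f]
  by (intro semi_riemannian_manifold_warped_product semi_riemannian_manifold_conformal
      semi_riemannian_manifold_pseudo_euclidean fibre)
    (auto simp: smooth_function_def smooth_in_chart_def)

lemma \<epsilon>_square [simp]: "\<epsilon> i * \<epsilon> i = 1"
  using signs[of i] by auto

lemma g_block_diag:
  "g ((), d) (x, q) = block_diag ((1 / (\<phi> (\<xi> x))\<^sup>2) *\<^sub>R (\<chi> i j. if i = j then \<epsilon> i else 0)) ((f (\<xi> x))\<^sup>2 *\<^sub>R gF d q)"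
  by (simp add: warped_product_metric_block_diag conformal_metric_def pseudo_euclidean_metric_def)

lemma matrix_inv_g:
  assumes "d \<in> charts F" "q \<in> chart_dom F d"
  shows "matrix_inv (g ((), d) (x, q)) = block_diag
    ((\<phi> (\<xi> x))\<^sup>2 *\<^sub>R (\<chi> i j. if i = j then \<epsilon> i else 0)) (inverse ((f (\<xi> x))\<^sup>2) *\<^sub>R matrix_inv (gF d q))"
proof -
  let ?E = "\<chi> i j. if i = j then \<epsilon> i else 0"
  have *: "?E ** ?E = mat 1"
    by (simp add: vec_eq_iff matrix_matrix_mult_def mat_def sum_delta_mult)
  then have "matrix_inv ?E = ?E" "invertible ?E" by (auto intro: matrix_inv_unique simp: invertible_def)
  then show ?thesis
    using semi_riemannian_metricD(3)[OF metric_fibre assms] \<phi>_pos[of "\<xi> x"] f_pos[of "\<xi> x"]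
    by (simp add: g_block_diag matrix_inv_block_diag matrix_inv_scaleR invertible_scaleR)
qed

section \<open>Christoffel symbols in a product chart at a fixed fibre point\<close>

context
  fixes d :: 'd and q :: 'q
  assumes d: "d \<in> charts F" and q: "q \<in> chart_dom F d"
begin

text \<open>The chain rule through the linear form \<xi>, whose i-th partial derivative is
  \<open>\<alpha> i\<close>. The factor k may depend on the fixed fibre point q, as for the
  components of gF.\<close>

lemma coord_deriv_base:
  assumes "\<And>x'. u (x', q) = w (\<xi> x') * k" "(w has_real_derivative w') (at (\<xi> x))"
  shows "coord_deriv M ((), d) (Inl i) u (x, q) = \<alpha> i * w' * k"
proof -
  have "((\<lambda>x. w (\<xi> x)) has_derivative (\<lambda>v. w' * \<xi> v)) (at x)"
    using has_derivative_compose[OF bounded_linear_imp_has_derivative[OF \<xi>_linear]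
        assms(2)[unfolded has_field_derivative_def]] by simp
  note pd_has_derivative[OF has_derivative_mult_left[OF this, of k], of "axis i 1"]
  then show ?thesis
    using d q by (subst coord_deriv_product_Inl[OF smooth_manifold_euclidean smooth_manifold_fibre])
      (auto simp: assms(1) coord_deriv_def \<xi>_axis)
qed

lemma coord_deriv_base_const:
  assumes "\<And>x'. u (x', q) = k"
  shows "coord_deriv M ((), d) (Inl i) u (x, q) = 0"
  using coord_deriv_base[of u "\<lambda>_. k" 1 0] assms by simp

text \<open>Equality is required only for q' in the chart domain, since gF is known to be invertible
  only there and the Christoffel formulas rest on its inverse.\<close>

lemma coord_deriv_fibre:
  assumes "\<And>q'. q' \<in> chart_dom F d \<Longrightarrow> u (x, q') = v q'"
  shows "coord_deriv M ((), d) (Inr a) u (x, q) = coord_deriv F d a v q"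
  using d q assms
  by (subst coord_deriv_product_Inr[OF smooth_manifold_euclidean smooth_manifold_fibre])
    (auto intro: coord_deriv_cong[OF smooth_manifold_fibre d q])

lemma coord_deriv_fibre_const:
  assumes "\<And>q'. q' \<in> chart_dom F d \<Longrightarrow> u (x, q') = k"
  shows "coord_deriv M ((), d) (Inr a) u (x, q) = 0"
  using coord_deriv_fibre[of u x "\<lambda>_. k"] assms by simp

lemma coord_deriv_zero:
  assumes "\<And>x q. q \<in> chart_dom F d \<Longrightarrow> u (x, q) = 0"
  shows "coord_deriv M ((), d) s u (x, q) = 0"
  using assms q coord_deriv_base_const[of u 0] coord_deriv_fibre_const[of u x 0] by (cases s) auto

lemma coord_deriv_g_base:
  "coord_deriv M ((), d) (Inl i) (\<lambda>z. g ((), d) z $ Inl j $ Inl k) (x, q)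
     = \<alpha> i * (- 2 * \<psi> (\<xi> x) / (\<phi> (\<xi> x))\<^sup>2) * (if j = k then \<epsilon> j else 0)"
  "coord_deriv M ((), d) (Inl i) (\<lambda>z. g ((), d) z $ Inr a $ Inr b) (x, q)
     = \<alpha> i * (2 * f (\<xi> x) * deriv f (\<xi> x)) * gF d q $ a $ b"
proof (rule coord_deriv_base)
  show "((\<lambda>t. 1 / (\<phi> t)\<^sup>2) has_real_derivative - 2 * \<psi> (\<xi> x) / (\<phi> (\<xi> x))\<^sup>2) (at (\<xi> x))"
    using \<phi>_pos[of "\<xi> x"] unfolding \<psi>_def
    by (auto intro!: derivative_eq_intros DERIVs simp: field_simps power2_eq_square)
  show "coord_deriv M ((), d) (Inl i) (\<lambda>z. g ((), d) z $ Inr a $ Inr b) (x, q)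
     = \<alpha> i * (2 * f (\<xi> x) * deriv f (\<xi> x)) * gF d q $ a $ b"
    by (rule coord_deriv_base[where w = "\<lambda>t. (f t)\<^sup>2"])
      (auto simp: g_block_diag intro!: derivative_eq_intros DERIVs)
qed (simp add: g_block_diag)

lemma coord_deriv_g_fibre:
  "coord_deriv M ((), d) (Inr c) (\<lambda>z. g ((), d) z $ Inl j $ Inl k) (x, q) = 0"
  "coord_deriv M ((), d) (Inr c) (\<lambda>z. g ((), d) z $ Inr a $ Inr b) (x, q)
     = (f (\<xi> x))\<^sup>2 * coord_deriv F d c (\<lambda>q. gF d q $ a $ b) q"
proof -
  show "coord_deriv M ((), d) (Inr c) (\<lambda>z. g ((), d) z $ Inl j $ Inl k) (x, q) = 0"
    by (rule coord_deriv_fibre_const) (simp add: g_block_diag)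
  have "coord_deriv M ((), d) (Inr c) (\<lambda>z. g ((), d) z $ Inr a $ Inr b) (x, q)
     = coord_deriv F d c (\<lambda>q. (f (\<xi> x))\<^sup>2 * gF d q $ a $ b) q"
    by (rule coord_deriv_fibre) (simp add: g_block_diag)
  then show "coord_deriv M ((), d) (Inr c) (\<lambda>z. g ((), d) z $ Inr a $ Inr b) (x, q)
     = (f (\<xi> x))\<^sup>2 * coord_deriv F d c (\<lambda>q. gF d q $ a $ b) q"
    using coord_deriv_cmult[OF smooth_manifold_fibre d q semi_riemannian_metricD(1)[OF metric_fibre d]]
    by simp
qed

lemma coord_deriv_g_mixed:
  "coord_deriv M ((), d) s (\<lambda>z. g ((), d) z $ Inl j $ Inr b) (x, q) = 0"
  "coord_deriv M ((), d) s (\<lambda>z. g ((), d) z $ Inr a $ Inl k) (x, q) = 0"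
  by (rule coord_deriv_zero, simp add: g_block_diag)+

lemmas christoffel_simps = christoffel_def sum_UNIV_Plus matrix_inv_g[OF d q]
  coord_deriv_g_base coord_deriv_g_fibre coord_deriv_g_mixed

text \<open>The inverse metric is diagonal, so only l = k contributes. Its factor
  \<open>(\<phi> (\<xi> x))\<^sup>2\<close> cancels the denominator of the differentiated metric,
  and \<open>\<epsilon> k * \<epsilon> k = 1\<close> removes the signs from the first two terms of
  \<open>\<kappa>\<close>.\<close>

lemma christoffel_base:
  "christoffel M g ((), d) (Inl k) (Inl i) (Inl j) (x, q) = - \<psi> (\<xi> x) * \<kappa> k i j"
proof -
  have "christoffel M g ((), d) (Inl k) (Inl i) (Inl j) (x, q) =
    1 / 2 * (\<Sum>l\<in>UNIV. (if k = l then (\<phi> (\<xi> x))\<^sup>2 * \<epsilon> l else 0) * (- 2 * \<psi> (\<xi> x) / (\<phi> (\<xi> x))\<^sup>2 *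
      (\<alpha> i * (if j = l then \<epsilon> j else 0) + \<alpha> j * (if i = l then \<epsilon> i else 0) - \<alpha> l * (if i = j then \<epsilon> i else 0))))"
    unfolding christoffel_simps by (simp add: algebra_simps cong: if_cong) (auto intro!: sum.cong simp: algebra_simps)
  also have "\<dots> = - \<psi> (\<xi> x) * \<kappa> k i j"
    using \<phi>_pos[of "\<xi> x"] unfolding sum_delta_mult by (auto simp: \<kappa>_def field_simps)
  finally show ?thesis .
qed

lemma christoffel_zero:
  "christoffel M g ((), d) (Inr c) (Inl i) (Inl j) (x, q) = 0"
  "christoffel M g ((), d) (Inl k) (Inl i) (Inr a) (x, q) = 0"
  "christoffel M g ((), d) (Inl k) (Inr a) (Inl i) (x, q) = 0"
  by (simp_all add: christoffel_simps)

text \<open>These are the components of -f grad f tensored with gF: of the three metric derivatives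
  only that of the fibre block in a base direction survives, and raising its index gives
  \<open>\<phi>\<^sup>2 * \<epsilon> k\<close>.\<close>

lemma christoffel_base_fibre:
  "christoffel M g ((), d) (Inl k) (Inr a) (Inr b) (x, q) = \<omega> (\<xi> x) * (- \<epsilon> k * \<alpha> k * gF d q $ a $ b)"
proof -
  have "christoffel M g ((), d) (Inl k) (Inr a) (Inr b) (x, q) =
    1 / 2 * (\<Sum>l\<in>UNIV. (if k = l then (\<phi> (\<xi> x))\<^sup>2 * \<epsilon> l else 0) *
      (- \<alpha> l * (2 * f (\<xi> x) * deriv f (\<xi> x)) * gF d q $ a $ b))"
    unfolding christoffel_simps by (simp cong: if_cong) (auto intro!: sum.cong)
  also have "\<dots> = \<omega> (\<xi> x) * (- \<epsilon> k * \<alpha> k * gF d q $ a $ b)"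
    unfolding sum_delta_mult by (simp add: \<omega>_def algebra_simps)
  finally show ?thesis .
qed

lemma matrix_inv_gF_mult:
  "(\<Sum>l\<in>UNIV. matrix_inv (gF d q) $ c $ l * gF d q $ a $ l) = (if c = a then 1 else 0)"
proof -
  have "(matrix_inv (gF d q) ** transpose (gF d q)) $ c $ a = (mat 1 :: real ^ 'm ^ 'm) $ c $ a"
    using matrix_inv_works(2)[OF semi_riemannian_metricD(3)[OF metric_fibre d q]]
      semi_riemannian_metricD(2)[OF metric_fibre d q] by simp
  then show ?thesis by (simp add: matrix_matrix_mult_def transpose_def mat_def)
qed

text \<open>The derivative 2 f f' of the warping factor meets \<open>1 / f\<^sup>2\<close> from the
  inverse metric, leaving f' / f; the contraction of gF with its inverse is the Kronecker
  delta.\<close>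

lemma christoffel_mixed:
  "christoffel M g ((), d) (Inr c) (Inl i) (Inr a) (x, q) = \<rho> (\<xi> x) * (if c = a then \<alpha> i else 0)"
  "christoffel M g ((), d) (Inr c) (Inr a) (Inl i) (x, q) = \<rho> (\<xi> x) * (if c = a then \<alpha> i else 0)"
proof -
  have "1 / 2 * (\<Sum>l\<in>UNIV. inverse ((f (\<xi> x))\<^sup>2) * matrix_inv (gF d q) $ c $ l *
      (\<alpha> i * (2 * f (\<xi> x) * deriv f (\<xi> x)) * gF d q $ a $ l))
    = (\<Sum>l\<in>UNIV. \<rho> (\<xi> x) * \<alpha> i * (matrix_inv (gF d q) $ c $ l * gF d q $ a $ l))"
    using f_pos[of "\<xi> x"] unfolding sum_distrib_left
    by (intro sum.cong) (auto simp: \<rho>_def field_simps power2_eq_square)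
  also have "\<dots> = \<rho> (\<xi> x) * \<alpha> i * (if c = a then 1 else 0)"
    unfolding sum_distrib_left[symmetric] matrix_inv_gF_mult ..
  finally show "christoffel M g ((), d) (Inr c) (Inl i) (Inr a) (x, q) = \<rho> (\<xi> x) * (if c = a then \<alpha> i else 0)"
    "christoffel M g ((), d) (Inr c) (Inr a) (Inl i) (x, q) = \<rho> (\<xi> x) * (if c = a then \<alpha> i else 0)"
    by (auto simp: christoffel_simps)
qed

text \<open>The warping factor is constant along the fibre, so it leaves the derivatives and cancels
  against the inverse metric.\<close>

lemma christoffel_fibre:
  "christoffel M g ((), d) (Inr c) (Inr a) (Inr b) (x, q) = christoffel F gF d c a b q"
proof -
  have cancel: "inverse k * m * (k * u + k * v - k * w) = m * (u + v - w)" if "k \<noteq> 0" for k m u v w :: real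
    using that by (simp add: field_simps)
  have "(f (\<xi> x))\<^sup>2 \<noteq> 0" using f_pos[of "\<xi> x"] by simp
  then show ?thesis by (simp add: christoffel_simps) (intro sum.cong refl cancel, simp)
qed


lemmas christoffel_M = christoffel_base christoffel_zero christoffel_base_fibre christoffel_mixed
  christoffel_fibre

end

section \<open>Contractions of the coefficients along the null direction\<close>

lemma null_sum: "(\<Sum>i\<in>UNIV. \<epsilon> i * (\<alpha> i * \<alpha> i)) = 0"
  using null by (simp add: power2_eq_square)

text \<open>In the first and third contractions the terms of \<alpha> paired with itself through
  \<epsilon> form the null sum and drop out. In the trace, the two terms with r = k cancel because
  \<open>\<epsilon> k * \<epsilon> k = 1\<close>, which leaves CARD('n) copies of
  \<open>\<alpha> k\<close>.\<close>

lemma \<kappa>_contract: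
  "(\<Sum>r\<in>UNIV. \<alpha> r * \<kappa> r j k) = 2 * \<alpha> j * \<alpha> k"
  "(\<Sum>r\<in>UNIV. \<kappa> r r k) = real CARD('n) * \<alpha> k"
  "(\<Sum>r\<in>UNIV. \<Sum>s\<in>UNIV. \<kappa> r j s * \<kappa> s r k) = (real CARD('n) + 2) * \<alpha> j * \<alpha> k"
proof -
  have null': "(\<Sum>r\<in>UNIV. \<alpha> r * (\<epsilon> i * \<epsilon> r * \<alpha> r)) = 0" for i
  proof -
    have "(\<Sum>r\<in>UNIV. \<alpha> r * (\<epsilon> i * \<epsilon> r * \<alpha> r)) = \<epsilon> i * (\<Sum>r\<in>UNIV. \<epsilon> r * (\<alpha> r * \<alpha> r))"
      unfolding sum_distrib_left by (simp add: mult_ac)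
    then show ?thesis by (simp add: null_sum)
  qed
  have expand: "\<kappa> r i l * u = (if l = r then \<alpha> i * u else 0) + (if i = r then \<alpha> l * u else 0)
      - (if i = l then \<epsilon> i * \<epsilon> r * \<alpha> r * u else 0)" for r i l u
    by (auto simp: \<kappa>_def algebra_simps)
  show 1: "(\<Sum>r\<in>UNIV. \<alpha> r * \<kappa> r j k) = 2 * \<alpha> j * \<alpha> k" for j k
  proof -
    have "(\<Sum>r\<in>UNIV. \<alpha> r * \<kappa> r j k) = \<alpha> j * \<alpha> k + \<alpha> k * \<alpha> j
        - (if j = k then \<Sum>r\<in>UNIV. \<alpha> r * (\<epsilon> j * \<epsilon> r * \<alpha> r) else 0)"
      unfolding mult.commute[of "\<alpha> _" "\<kappa> _ _ _"] expand
      by (simp add: sum.distrib sum_subtractf mult.commute)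
    then show ?thesis using null' by (simp split: if_split)
  qed
  show 2: "(\<Sum>r\<in>UNIV. \<kappa> r r k) = real CARD('n) * \<alpha> k" for k
    by (simp add: \<kappa>_def sum.distrib sum_subtractf)
  \<comment> \<open>Only the first factor is expanded. Its three Kronecker terms produce a trace
    term, the contraction 1, and a remainder that vanishes after summation over r by 4.\<close>
  have 3: "(\<Sum>s\<in>UNIV. \<kappa> r j s * \<kappa> s r k)
      = \<alpha> j * \<kappa> r r k + (if j = r then 2 * \<alpha> r * \<alpha> k else 0) - \<epsilon> j * (\<epsilon> r * (\<alpha> r * \<kappa> j r k))" for r
  proof -
    have "(\<Sum>s\<in>UNIV. \<kappa> r j s * \<kappa> s r k) = \<alpha> j * \<kappa> r r k
        + (if j = r then \<Sum>s\<in>UNIV. \<alpha> s * \<kappa> s r k else 0) - \<epsilon> j * \<epsilon> r * \<alpha> r * \<kappa> j r k"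
      unfolding expand[of r j] by (simp add: sum.distrib sum_subtractf)
    then show ?thesis by (simp add: 1 mult.assoc)
  qed
  \<comment> \<open>For j = k one term is the null sum; the other two give
    \<open>\<epsilon> j * \<alpha> j * \<alpha> k\<close> with opposite signs.\<close>
  have 4: "(\<Sum>r\<in>UNIV. \<epsilon> r * (\<alpha> r * \<kappa> j r k)) = 0"
  proof -
    have "\<epsilon> r * (\<alpha> r * \<kappa> j r k) = (if j = k then \<epsilon> r * (\<alpha> r * \<alpha> r) else 0)
        + (if j = r then \<epsilon> r * \<alpha> r * \<alpha> k else 0) - (if r = k then \<epsilon> j * (\<alpha> r * \<alpha> j) else 0)" for r
      by (auto simp: \<kappa>_def algebra_simps)
    moreover have "(\<Sum>r\<in>UNIV. if j = k then \<epsilon> r * (\<alpha> r * \<alpha> r) else 0) = 0"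
      using null_sum by (cases "j = k") auto
    ultimately show ?thesis by (simp add: sum.distrib sum_subtractf mult.commute)
  qed
  show "(\<Sum>r\<in>UNIV. \<Sum>s\<in>UNIV. \<kappa> r j s * \<kappa> s r k) = (real CARD('n) + 2) * \<alpha> j * \<alpha> k"
  proof -
    have "(\<Sum>r\<in>UNIV. \<Sum>s\<in>UNIV. \<kappa> r j s * \<kappa> s r k) = \<alpha> j * (\<Sum>r\<in>UNIV. \<kappa> r r k) + 2 * \<alpha> j * \<alpha> k
        - \<epsilon> j * (\<Sum>r\<in>UNIV. \<epsilon> r * (\<alpha> r * \<kappa> j r k))"
      unfolding 3 by (simp add: sum.distrib sum_subtractf sum_distrib_left)
    then show ?thesis unfolding 2 4 by (simp add: algebra_simps)
  qed
qed

section \<open>Hessian and Ricci tensor of the warped product\<close>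

context
  fixes d :: 'd and q :: 'q
  assumes d: "d \<in> charts F" and q: "q \<in> chart_dom F d"
begin

text \<open>Fibre derivatives need the Christoffel formulas at all fibre points of the chart, not
  only at q. The context was closed and reopened to generalise them, which gives
  \<open>christoffel_M[OF d]\<close> its free point.\<close>

lemma coord_deriv_christoffel_base:
  "coord_deriv M ((), d) (Inl r) (christoffel M g ((), d) (Inl k) (Inl i) (Inl j)) (x, q)
     = \<alpha> r * - (deriv (deriv \<phi>) (\<xi> x) / \<phi> (\<xi> x) - (\<psi> (\<xi> x))\<^sup>2) * \<kappa> k i j"
  "coord_deriv M ((), d) (Inr a) (christoffel M g ((), d) (Inl k) (Inl i) (Inl j)) (x, q) = 0"
proof -
  show "coord_deriv M ((), d) (Inl r) (christoffel M g ((), d) (Inl k) (Inl i) (Inl j)) (x, q)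
     = \<alpha> r * - (deriv (deriv \<phi>) (\<xi> x) / \<phi> (\<xi> x) - (\<psi> (\<xi> x))\<^sup>2) * \<kappa> k i j"
    by (rule coord_deriv_base[OF d q _ DERIV_minus[OF DERIV_\<psi>]]) (rule christoffel_M[OF d q])
  show "coord_deriv M ((), d) (Inr a) (christoffel M g ((), d) (Inl k) (Inl i) (Inl j)) (x, q) = 0"
    by (rule coord_deriv_fibre_const[OF d q]) (rule christoffel_M[OF d])
qed

lemma coord_deriv_christoffel_mixed:
  "coord_deriv M ((), d) (Inl r) (christoffel M g ((), d) (Inr c) (Inr a) (Inl i)) (x, q)
     = \<alpha> r * (deriv (deriv f) (\<xi> x) / f (\<xi> x) - (\<rho> (\<xi> x))\<^sup>2) * (if c = a then \<alpha> i else 0)"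
  "coord_deriv M ((), d) (Inr b) (christoffel M g ((), d) (Inr c) (Inr a) (Inl i)) (x, q) = 0"
  "coord_deriv M ((), d) (Inr b) (christoffel M g ((), d) (Inr c) (Inl i) (Inr a)) (x, q) = 0"
proof -
  show "coord_deriv M ((), d) (Inl r) (christoffel M g ((), d) (Inr c) (Inr a) (Inl i)) (x, q)
     = \<alpha> r * (deriv (deriv f) (\<xi> x) / f (\<xi> x) - (\<rho> (\<xi> x))\<^sup>2) * (if c = a then \<alpha> i else 0)"
    by (rule coord_deriv_base[OF d q]) (rule christoffel_M[OF d q] DERIV_\<rho>)+
  show "coord_deriv M ((), d) (Inr b) (christoffel M g ((), d) (Inr c) (Inr a) (Inl i)) (x, q) = 0"
    "coord_deriv M ((), d) (Inr b) (christoffel M g ((), d) (Inr c) (Inl i) (Inr a)) (x, q) = 0"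
    by (rule coord_deriv_fibre_const[OF d q], rule christoffel_M[OF d], assumption)+
qed

lemma coord_deriv_christoffel_zero:
  "coord_deriv M ((), d) s (christoffel M g ((), d) (Inr c) (Inl i) (Inl j)) (x, q) = 0"
  "coord_deriv M ((), d) s (christoffel M g ((), d) (Inl k) (Inl i) (Inr a)) (x, q) = 0"
  "coord_deriv M ((), d) s (christoffel M g ((), d) (Inl k) (Inr a) (Inl i)) (x, q) = 0"
  by (rule coord_deriv_zero[OF d q], rule christoffel_zero[OF d], assumption)+

text \<open>Base derivatives suffice: in the divergence term of the Ricci tensor the upper base
  index is contracted with the index of differentiation.\<close>

lemma coord_deriv_christoffel_base_fibre:
  "coord_deriv M ((), d) (Inl r) (christoffel M g ((), d) (Inl k) (Inr a) (Inr b)) (x, q)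
     = \<alpha> r * deriv \<omega> (\<xi> x) * (- \<epsilon> k * \<alpha> k * gF d q $ a $ b)"
  by (rule coord_deriv_base[OF d q]) (rule christoffel_M[OF d q] DERIV_\<omega>)+

lemma coord_deriv_christoffel_fibre:
  "coord_deriv M ((), d) (Inl r) (christoffel M g ((), d) (Inr c) (Inr a) (Inr b)) (x, q) = 0"
  "coord_deriv M ((), d) (Inr e) (christoffel M g ((), d) (Inr c) (Inr a) (Inr b)) (x, q)
     = coord_deriv F d e (christoffel F gF d c a b) q"
proof -
  show "coord_deriv M ((), d) (Inl r) (christoffel M g ((), d) (Inr c) (Inr a) (Inr b)) (x, q) = 0"
    by (rule coord_deriv_base_const[OF d q]) (rule christoffel_M[OF d q])
  show "coord_deriv M ((), d) (Inr e) (christoffel M g ((), d) (Inr c) (Inr a) (Inr b)) (x, q)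
     = coord_deriv F d e (christoffel F gF d c a b) q"
    by (rule coord_deriv_fibre[OF d q]) (rule christoffel_M[OF d])
qed

lemmas ricci_M_simps = sum_UNIV_Plus christoffel_M[OF d q]
  coord_deriv_christoffel_base coord_deriv_christoffel_mixed coord_deriv_christoffel_zero
  coord_deriv_christoffel_base_fibre coord_deriv_christoffel_fibre

text \<open>Classically the trace is the derivative of log sqrt |det g|. Here |det g| is
  \<open>\<phi>\<^sup>-\<^sup>2\<^sup>n f\<^sup>2\<^sup>m\<close> |det gF|, which explains the
  coefficients m and -n.\<close>

lemma christoffel_trace:
  "(\<Sum>r\<in>UNIV. christoffel M g ((), d) r r (Inl k) (x, q))
     = (real CARD('m) * \<rho> (\<xi> x) - real CARD('n) * \<psi> (\<xi> x)) * \<alpha> k"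
  "(\<Sum>r\<in>UNIV. christoffel M g ((), d) r r (Inr a) (x, q)) = (\<Sum>c\<in>UNIV. christoffel F gF d c c a q)"
  by (simp_all add: ricci_M_simps sum_distrib_left[symmetric] sum_negf \<kappa>_contract algebra_simps)

text \<open>The summand \<open>2 * \<psi> * h'\<close> is the connection term, with 2 from the
  contraction of \<open>\<kappa>\<close> with \<alpha>. In fibre directions the connection term
  pairs the gradients of f and h, both multiples of the gradient of \<xi>, and so contains the null
  sum.\<close>

lemma hessian_M:
  assumes "\<And>t. (h has_real_derivative deriv h t) (at t)"
    and "\<And>t. (deriv h has_real_derivative deriv (deriv h) t) (at t)"
  shows "hessian M g (\<lambda>(x, q). h (\<xi> x)) ((), d) (Inl j) (Inl k) (x, q)
      = \<alpha> j * \<alpha> k * (deriv (deriv h) (\<xi> x) + 2 * \<psi> (\<xi> x) * deriv h (\<xi> x))"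
    and "hessian M g (\<lambda>(x, q). h (\<xi> x)) ((), d) (Inl j) (Inr a) (x, q) = 0"
    and "hessian M g (\<lambda>(x, q). h (\<xi> x)) ((), d) (Inr a) (Inl j) (x, q) = 0"
    and "hessian M g (\<lambda>(x, q). h (\<xi> x)) ((), d) (Inr a) (Inr b) (x, q) = 0"
proof -
  let ?h = "\<lambda>(x, q). h (\<xi> x)"
  \<comment> \<open>Stated for every q' of the chart domain, because these derivatives are
    differentiated again, also along the fibre.\<close>
  have grad: "coord_deriv M ((), d) (Inl k) ?h (x, q') = deriv h (\<xi> x) * \<alpha> k"
    "coord_deriv M ((), d) (Inr a) ?h (x, q') = 0" if "q' \<in> chart_dom F d" for k a x q'
    using coord_deriv_base[OF d that, of ?h h 1 "deriv h (\<xi> x)" x k] coord_deriv_fibre_const[OF d that, of ?h x]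
      assms(1) by auto
  have second: "coord_deriv M ((), d) (Inl j) (coord_deriv M ((), d) (Inl k) ?h) (x, q)
      = \<alpha> j * deriv (deriv h) (\<xi> x) * \<alpha> k"
    "coord_deriv M ((), d) (Inr a) (coord_deriv M ((), d) (Inl k) ?h) (x, q) = 0"
    "coord_deriv M ((), d) s (coord_deriv M ((), d) (Inr a) ?h) (x, q) = 0" for j k a s
  proof -
    show "coord_deriv M ((), d) (Inl j) (coord_deriv M ((), d) (Inl k) ?h) (x, q)
        = \<alpha> j * deriv (deriv h) (\<xi> x) * \<alpha> k"
      by (rule coord_deriv_base[OF d q]) (rule grad(1)[OF q] assms(2))+
    show "coord_deriv M ((), d) (Inr a) (coord_deriv M ((), d) (Inl k) ?h) (x, q) = 0"
      by (rule coord_deriv_fibre_const[OF d q]) (rule grad(1))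
    show "coord_deriv M ((), d) s (coord_deriv M ((), d) (Inr a) ?h) (x, q) = 0"
      by (rule coord_deriv_zero[OF d q]) (rule grad(2))
  qed
  note simps = hessian_def sum_UNIV_Plus christoffel_M[OF d q] grad[OF q] second
  have "(\<Sum>i\<in>UNIV. - \<psi> (\<xi> x) * \<kappa> i j k * (deriv h (\<xi> x) * \<alpha> i))
      = - \<psi> (\<xi> x) * deriv h (\<xi> x) * (\<Sum>i\<in>UNIV. \<alpha> i * \<kappa> i j k)"
    by (simp add: sum_distrib_left mult_ac sum_negf)
  then show "hessian M g ?h ((), d) (Inl j) (Inl k) (x, q)
      = \<alpha> j * \<alpha> k * (deriv (deriv h) (\<xi> x) + 2 * \<psi> (\<xi> x) * deriv h (\<xi> x))"
    unfolding simps by (simp add: \<kappa>_contract algebra_simps)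
  show "hessian M g ?h ((), d) (Inl j) (Inr a) (x, q) = 0"
    "hessian M g ?h ((), d) (Inr a) (Inl j) (x, q) = 0"
    unfolding simps by simp_all
  have "(\<Sum>i\<in>UNIV. \<omega> (\<xi> x) * (- \<epsilon> i * \<alpha> i * gF d q $ a $ b) * (deriv h (\<xi> x) * \<alpha> i))
      = - \<omega> (\<xi> x) * gF d q $ a $ b * deriv h (\<xi> x) * (\<Sum>i\<in>UNIV. \<epsilon> i * (\<alpha> i * \<alpha> i))"
    by (simp add: sum_distrib_left mult_ac sum_negf)
  then show "hessian M g ?h ((), d) (Inr a) (Inr b) (x, q) = 0"
    unfolding simps by (simp add: null_sum)
qed

text \<open>Collecting 1 to 4, \<open>\<psi>'\<close> has coefficient n - 2 and
  \<open>\<psi>\<^sup>2\<close> has 2 n - (n + 2), which combine to (n - 2)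
  \<open>\<phi>'' / \<phi>\<close>. Likewise \<open>\<rho>'\<close> and
  \<open>\<rho>\<^sup>2\<close> both have coefficient -m and give f'' / f. The cross term comes from
  the fibre part of the trace in 3.\<close>

lemma ricci_base:
  "ricci M g ((), d) (Inl j) (Inl k) (x, q) = \<alpha> j * \<alpha> k *
     ((real CARD('n) - 2) * (deriv (deriv \<phi>) (\<xi> x) / \<phi> (\<xi> x))
      - real CARD('m) * (deriv (deriv f) (\<xi> x) / f (\<xi> x) + 2 * \<rho> (\<xi> x) * \<psi> (\<xi> x)))"
proof -
  let ?\<psi> = "\<psi> (\<xi> x)" and ?\<rho> = "\<rho> (\<xi> x)" and ?t = "\<xi> x" and ?n = "real CARD('n)" and ?m = "real CARD('m)"
  let ?d\<psi> = "deriv (deriv \<phi>) ?t / \<phi> ?t - ?\<psi>\<^sup>2" and ?d\<rho> = "deriv (deriv f) ?t / f ?t - ?\<rho>\<^sup>2"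
  let ?\<Gamma> = "\<lambda>k i j. christoffel M g ((), d) k i j (x, q)"
  have 1: "(\<Sum>r\<in>UNIV. coord_deriv M ((), d) r (christoffel M g ((), d) r (Inl j) (Inl k)) (x, q))
      = - ?d\<psi> * (\<Sum>r\<in>UNIV. \<alpha> r * \<kappa> r j k)"
    by (simp add: ricci_M_simps sum_distrib_left) (simp add: algebra_simps sum_subtractf)
  have 2: "(\<Sum>r\<in>UNIV. coord_deriv M ((), d) (Inl j) (christoffel M g ((), d) r r (Inl k)) (x, q))
      = \<alpha> j * - ?d\<psi> * (\<Sum>r\<in>UNIV. \<kappa> r r k) + ?m * \<alpha> j * ?d\<rho> * \<alpha> k"
    by (simp add: ricci_M_simps sum_distrib_left)
  have 3: "(\<Sum>s\<in>UNIV. (\<Sum>r\<in>UNIV. ?\<Gamma> r r s) * ?\<Gamma> s (Inl j) (Inl k))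
      = - ((?m * ?\<rho> - ?n * ?\<psi>) * (?\<psi> * (\<Sum>r\<in>UNIV. \<alpha> r * \<kappa> r j k)))"
    \<comment> \<open>The instantiation splits only the outer sum; the inner trace stays whole so
      that \<open>christoffel_trace\<close> applies.\<close>
    by (subst sum_UNIV_Plus[where w = "\<lambda>s. _ s * ?\<Gamma> s _ _"])
      (simp add: christoffel_trace christoffel_M[OF d q] sum_distrib_left sum_distrib_right mult_ac sum_negf)
  have 4: "(\<Sum>r\<in>UNIV. \<Sum>s\<in>UNIV. ?\<Gamma> r (Inl j) s * ?\<Gamma> s r (Inl k))
      = ?\<psi>\<^sup>2 * (\<Sum>r\<in>UNIV. \<Sum>s\<in>UNIV. \<kappa> r j s * \<kappa> s r k) + ?m * ?\<rho>\<^sup>2 * \<alpha> j * \<alpha> k"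
    by (simp add: ricci_M_simps sum_distrib_left power2_eq_square mult_ac sum_delta_mult
        if_distrib[where f = "\<lambda>x. x * _"] if_distrib[where f = "\<lambda>x. _ * x"] cong: if_cong)
  show ?thesis
    unfolding ricci_contracted 1 2 3 4 \<kappa>_contract
    by (simp add: algebra_simps power2_eq_square add_divide_distrib diff_divide_distrib)
qed

text \<open>All derivative terms vanish. The trace product and the double sum both reduce to
  \<open>\<rho> * \<alpha> j\<close> times the Christoffel trace of the fibre and cancel. In the
  second order of indices one copy has its lower fibre indices exchanged, hence
  \<open>christoffel_commute\<close>.\<close>

lemma ricci_mixed:
  "ricci M g ((), d) (Inl j) (Inr a) (x, q) = 0"
  "ricci M g ((), d) (Inr a) (Inl j) (x, q) = 0"
proof -
  show "ricci M g ((), d) (Inl j) (Inr a) (x, q) = 0"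
    unfolding ricci_contracted
    by (subst (3) sum_UNIV_Plus) (simp add: christoffel_trace, simp add: ricci_M_simps
        sum_distrib_left mult_ac if_distrib[where f = "\<lambda>x. x * _"] if_distrib[where f = "\<lambda>x. _ * x"] cong: if_cong)
  show "ricci M g ((), d) (Inr a) (Inl j) (x, q) = 0"
    unfolding ricci_contracted
    by (subst (3) sum_UNIV_Plus) (simp add: christoffel_trace, simp add: ricci_M_simps
        sum_distrib_left mult_ac if_distrib[where f = "\<lambda>x. x * _"] if_distrib[where f = "\<lambda>x. _ * x"] cong: if_cong,
        intro sum.cong refl arg_cong2[where f = "(*)"] christoffel_commute[OF smooth_manifold_fibre metric_fibre d q])
qed

text \<open>For a general warped product a multiple of gF is added, built from the Laplacian and the
  squared gradient of f. Here its constituents appear as \<open>\<omega>'\<close>,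
  \<open>(m * \<rho> - n * \<psi>) * \<omega>\<close> and \<open>2 * \<rho> * \<omega>\<close>, each
  multiplied by the null sum.\<close>

lemma ricci_fibre: "ricci M g ((), d) (Inr a) (Inr b) (x, q) = ricci F gF d a b q"
proof -
  let ?\<Gamma> = "\<lambda>k i j. christoffel M g ((), d) k i j (x, q)"
  let ?\<Gamma>F = "\<lambda>k i j. christoffel F gF d k i j q"
  have 1: "(\<Sum>r\<in>UNIV. coord_deriv M ((), d) r (christoffel M g ((), d) r (Inr a) (Inr b)) (x, q))
      = - deriv \<omega> (\<xi> x) * gF d q $ a $ b * (\<Sum>i\<in>UNIV. \<epsilon> i * (\<alpha> i * \<alpha> i))
        + (\<Sum>r\<in>UNIV. coord_deriv F d r (christoffel F gF d r a b) q)"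
    by (simp add: ricci_M_simps sum_distrib_left mult_ac sum_negf)
  have 2: "(\<Sum>r\<in>UNIV. coord_deriv M ((), d) (Inr a) (christoffel M g ((), d) r r (Inr b)) (x, q))
      = (\<Sum>r\<in>UNIV. coord_deriv F d a (christoffel F gF d r r b) q)"
    by (simp add: ricci_M_simps)
  have 3: "(\<Sum>s\<in>UNIV. (\<Sum>r\<in>UNIV. ?\<Gamma> r r s) * ?\<Gamma> s (Inr a) (Inr b))
      = - ((real CARD('m) * \<rho> (\<xi> x) - real CARD('n) * \<psi> (\<xi> x)) * (\<omega> (\<xi> x) * gF d q $ a $ b
          * (\<Sum>i\<in>UNIV. \<epsilon> i * (\<alpha> i * \<alpha> i))))
        + (\<Sum>s\<in>UNIV. (\<Sum>r\<in>UNIV. ?\<Gamma>F r r s) * ?\<Gamma>F s a b)"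
    by (subst sum_UNIV_Plus[where w = "\<lambda>s. _ s * ?\<Gamma> s _ _"])
      (simp add: christoffel_trace christoffel_M[OF d q] sum_distrib_left sum_distrib_right mult_ac sum_negf)
  have if_sum: "(\<Sum>i\<in>UNIV. if P then u i else 0) = (if P then \<Sum>i\<in>UNIV. u i else 0)"
    for P and u :: "'n \<Rightarrow> real" by simp
  have 4: "(\<Sum>r\<in>UNIV. \<Sum>s\<in>UNIV. ?\<Gamma> r (Inr a) s * ?\<Gamma> s r (Inr b))
      = - (\<rho> (\<xi> x) * \<omega> (\<xi> x) * gF d q $ a $ b * (\<Sum>i\<in>UNIV. \<epsilon> i * (\<alpha> i * \<alpha> i)))
        - (\<rho> (\<xi> x) * \<omega> (\<xi> x) * gF d q $ a $ b * (\<Sum>i\<in>UNIV. \<epsilon> i * (\<alpha> i * \<alpha> i)))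
        + (\<Sum>r\<in>UNIV. \<Sum>s\<in>UNIV. ?\<Gamma>F r a s * ?\<Gamma>F s r b)"
    by (simp add: ricci_M_simps sum_distrib_left mult_ac sum_negf sum.distrib if_sum
        if_distrib[where f = "\<lambda>x. x * _"] if_distrib[where f = "\<lambda>x. _ * x"] cong: if_cong)
  show ?thesis
    unfolding ricci_contracted 1 2 3 4 null_sum by simp
qed

end

section \<open>Reduction of the soliton equation to the ordinary differential equation\<close>

theorem steady_gradient_ricci_soliton_M:
  assumes "ricci_flat F gF" and h: "smooth_on UNIV h"
    and ode: "\<And>t. (real CARD('n) - 2) * f t * deriv (deriv \<phi>) t
              + f t * \<phi> t * deriv (deriv h) t
              - real CARD('m) * \<phi> t * deriv (deriv f) t
              - 2 * real CARD('m) * deriv \<phi> t * deriv f t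
              + 2 * f t * deriv \<phi> t * deriv h t = 0"
  shows "steady_gradient_ricci_soliton M g (\<lambda>(x, q). h (\<xi> x))"
  unfolding steady_gradient_ricci_soliton_def
proof (intro conjI ballI allI)
  show "semi_riemannian_manifold M g" by (rule semi_riemannian_M)
  have "smooth_in_chart M ((), d) (\<lambda>z. h (\<xi> (fst z)))" if "d \<in> charts F" for d
    using smooth_in_chart_fst[OF smooth_manifold_euclidean smooth_manifold_fibre _ that, of "()" "\<lambda>x. h (\<xi> x)"]
      smooth_along_\<xi>[OF h] by (simp add: smooth_in_chart_def[of euclidean_manifold])
  then show "smooth_function M (\<lambda>(x, q). h (\<xi> x))"
    by (auto simp: smooth_function_def case_prod_unfold)
  fix e z s t assume "e \<in> charts M" "z \<in> chart_dom M e"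
  then obtain d x q where e: "e = ((), d)" "z = (x, q)" and d: "d \<in> charts F" and q: "q \<in> chart_dom F d"
    by (cases e; cases z) auto
  have flat: "ricci F gF d a b q = 0" for a b
    using assms(1) d q by (simp add: ricci_flat_def)
  \<comment> \<open>This is the equation \<open>ode\<close> divided by the positive function
    \<open>f t * \<phi> t\<close>; it is the common factor of all base components.\<close>
  have "(real CARD('n) - 2) * (deriv (deriv \<phi>) t / \<phi> t)
      - real CARD('m) * (deriv (deriv f) t / f t + 2 * \<rho> t * \<psi> t) + (deriv (deriv h) t + 2 * \<psi> t * deriv h t) = 0" for t
  proof -
    have "f t * \<phi> t * ((real CARD('n) - 2) * (deriv (deriv \<phi>) t / \<phi> t)
        - real CARD('m) * (deriv (deriv f) t / f t + 2 * \<rho> t * \<psi> t) + (deriv (deriv h) t + 2 * \<psi> t * deriv h t))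
      = (real CARD('n) - 2) * f t * deriv (deriv \<phi>) t + f t * \<phi> t * deriv (deriv h) t
        - real CARD('m) * \<phi> t * deriv (deriv f) t - 2 * real CARD('m) * deriv \<phi> t * deriv f t
        + 2 * f t * deriv \<phi> t * deriv h t"
      using \<phi>_pos[of t] f_pos[of t] by (simp add: \<rho>_def \<psi>_def field_simps)
    then show ?thesis using ode[of t] \<phi>_pos[of t] f_pos[of t] by simp
  qed
  from this[of "\<xi> x"] have "\<alpha> j * \<alpha> k * ((real CARD('n) - 2) * (deriv (deriv \<phi>) (\<xi> x) / \<phi> (\<xi> x))
      - real CARD('m) * (deriv (deriv f) (\<xi> x) / f (\<xi> x) + 2 * \<rho> (\<xi> x) * \<psi> (\<xi> x)))
      + \<alpha> j * \<alpha> k * (deriv (deriv h) (\<xi> x) + 2 * \<psi> (\<xi> x) * deriv h (\<xi> x)) = 0" for j k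
    unfolding distrib_left[symmetric] by simp
  moreover note hess = hessian_M[OF d q smooth_on_real_DERIV[OF h UNIV_I] smooth_on_real_DERIV[OF smooth_on_deriv[OF h] UNIV_I]]
  ultimately show "ricci M g e s t z + hessian M g (\<lambda>(x, q). h (\<xi> x)) e s t z = 0"
    unfolding e by (cases s; cases t)
      (simp_all only: ricci_base[OF d q] ricci_mixed[OF d q] ricci_fibre[OF d q] hess flat add_0)
qed

end

section \<open>The potential obtained by two quadratures\<close>

theorem theorem1p7:
  fixes \<epsilon> :: "'n::finite \<Rightarrow> real" and \<alpha> :: "'n \<Rightarrow> real"
    and F :: "('q, 'd, 'm::finite) manifold" and gF :: "('q, 'd, 'm) tensor2"
    and \<phi> f G H h :: "real \<Rightarrow> real" and c4 c5 :: real
    and \<xi> :: "real ^ 'n \<Rightarrow> real"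
  assumes "CARD('n) \<ge> 3"
    and "\<And>i. \<epsilon> i = 1 \<or> \<epsilon> i = -1"
    and "semi_riemannian_manifold F gF" and "ricci_flat F gF"
    and "smooth_on UNIV \<phi>" and "\<And>t. \<phi> t > 0"
    and "smooth_on UNIV f" and "\<And>t. f t > 0"
    and "(\<Sum>i\<in>UNIV. \<epsilon> i * (\<alpha> i)\<^sup>2) = 0"
    and "\<xi> = (\<lambda>x. \<Sum>i\<in>UNIV. \<alpha> i * x $ i)"
    and "G \<in> indefinite_integral (\<lambda>t.
           real CARD('m) * (deriv (deriv f) t / f t) * (\<phi> t)\<^sup>2
           + 2 * real CARD('m) * \<phi> t * deriv \<phi> t * (deriv f t / f t)
           - (real CARD('n) - 2) * \<phi> t * deriv (deriv \<phi>) t)"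
    and "H \<in> indefinite_integral (\<lambda>t. inverse ((\<phi> t)\<^sup>2) * (G t + c4))"
    and "h = (\<lambda>t. H t + c5)"
  shows "(\<forall>t. (real CARD('n) - 2) * f t * deriv (deriv \<phi>) t
              + f t * \<phi> t * deriv (deriv h) t
              - real CARD('m) * \<phi> t * deriv (deriv f) t
              - 2 * real CARD('m) * deriv \<phi> t * deriv f t
              + 2 * f t * deriv \<phi> t * deriv h t = 0)
       \<and> steady_gradient_ricci_soliton
           (product_manifold euclidean_manifold F)
           (warped_product_metric
              (conformal_metric (\<lambda>x. \<phi> (\<xi> x)) (pseudo_euclidean_metric \<epsilon>))
              (\<lambda>x. f (\<xi> x)) gF)
           (\<lambda>(x, q). h (\<xi> x))"
proof -
  interpret W: null_warped_product \<epsilon> \<alpha> \<phi> f F gF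
    by unfold_locales (use assms in auto)
  define G' where "G' t = real CARD('m) * (deriv (deriv f) t / f t) * (\<phi> t)\<^sup>2
           + 2 * real CARD('m) * \<phi> t * deriv \<phi> t * (deriv f t / f t)
           - (real CARD('n) - 2) * \<phi> t * deriv (deriv \<phi>) t" for t
  have G: "(G has_real_derivative G' t) (at t)" for t
    using assms(11) by (simp add: indefinite_integral_def G'_def)
  have h: "(h has_real_derivative inverse ((\<phi> t)\<^sup>2) * (G t + c4)) (at t)" for t
    using assms(12) unfolding assms(13)
    by (auto simp: indefinite_integral_def intro!: derivative_eq_intros)
  have inv_f: "smooth_on UNIV (\<lambda>t. inverse (f t))" and inv_\<phi>: "smooth_on UNIV (\<lambda>t. inverse (\<phi> t * \<phi> t))"
    using assms(5-8) by (auto intro!: smooth_on_inverse smooth_on_mult)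
  \<comment> \<open>The integrand is rewritten with sums, products and inverses only, the
    subtraction being absorbed into the coefficient 2 - n, to fit the closure rules for smooth
    functions.\<close>
  have "smooth_on UNIV (\<lambda>t. (real CARD('m) * (deriv (deriv f) t * inverse (f t)) * (\<phi> t * \<phi> t)
           + 2 * real CARD('m) * \<phi> t * deriv \<phi> t * (deriv f t * inverse (f t)))
           + (2 - real CARD('n)) * \<phi> t * deriv (deriv \<phi>) t)"
    using assms(5,7) inv_f
    by (intro smooth_on_add smooth_on_mult smooth_on_const smooth_on_deriv) auto
  moreover have "(\<lambda>t. (real CARD('m) * (deriv (deriv f) t * inverse (f t)) * (\<phi> t * \<phi> t)
           + 2 * real CARD('m) * \<phi> t * deriv \<phi> t * (deriv f t * inverse (f t)))
           + (2 - real CARD('n)) * \<phi> t * deriv (deriv \<phi>) t) = G'"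
    by (rule ext) (simp add: G'_def divide_inverse power2_eq_square algebra_simps)
  ultimately have "smooth_on UNIV G" using smooth_on_antiderivative[OF G] by simp
  then have "smooth_on UNIV (\<lambda>t. inverse (\<phi> t * \<phi> t) * (G t + c4))"
    using inv_\<phi> by (intro smooth_on_add smooth_on_mult smooth_on_const) auto
  then have smooth_h: "smooth_on UNIV h"
    using smooth_on_antiderivative[OF h] by (simp add: power2_eq_square)
  have dh: "deriv h = (\<lambda>t. inverse ((\<phi> t)\<^sup>2) * (G t + c4))"
    using h by (auto intro: DERIV_imp_deriv)
  have ode: "(real CARD('n) - 2) * f t * deriv (deriv \<phi>) t
              + f t * \<phi> t * deriv (deriv h) t
              - real CARD('m) * \<phi> t * deriv (deriv f) t
              - 2 * real CARD('m) * deriv \<phi> t * deriv f t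
              + 2 * f t * deriv \<phi> t * deriv h t = 0" for t
  proof -
    have "((\<lambda>t. (\<phi> t)\<^sup>2 * deriv h t) has_real_derivative
        2 * \<phi> t * deriv \<phi> t * deriv h t + (\<phi> t)\<^sup>2 * deriv (deriv h) t) (at t)"
      using smooth_on_real_DERIV[OF smooth_on_deriv[OF smooth_h]] W.DERIVs(1)
      by (auto intro!: derivative_eq_intros simp: power2_eq_square)
    \<comment> \<open>The outer quadrature says that this product is G + c4. Differentiating it in
      two ways yields h'' without differentiating a quotient.\<close>
    moreover have "(\<lambda>t. (\<phi> t)\<^sup>2 * deriv h t) = (\<lambda>t. G t + c4)"
      using W.\<phi>_pos by (auto simp: dh fun_eq_iff less_imp_neq[symmetric])
    ultimately have "((\<lambda>t. G t + c4) has_real_derivative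
        2 * \<phi> t * deriv \<phi> t * deriv h t + (\<phi> t)\<^sup>2 * deriv (deriv h) t) (at t)" by simp
    from DERIV_unique[OF this DERIV_add[OF G DERIV_const]]
    have "2 * \<phi> t * deriv \<phi> t * deriv h t + (\<phi> t)\<^sup>2 * deriv (deriv h) t = G' t" by simp
    moreover have "(real CARD('n) - 2) * f t * deriv (deriv \<phi>) t
              + f t * \<phi> t * deriv (deriv h) t
              - real CARD('m) * \<phi> t * deriv (deriv f) t
              - 2 * real CARD('m) * deriv \<phi> t * deriv f t
              + 2 * f t * deriv \<phi> t * deriv h t
        = f t / \<phi> t * (2 * \<phi> t * deriv \<phi> t * deriv h t + (\<phi> t)\<^sup>2 * deriv (deriv h) t - G' t)"
      using W.\<phi>_pos[of t] W.f_pos[of t] unfolding G'_def by (simp add: field_simps power2_eq_square)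
    ultimately show ?thesis by simp
  qed
  moreover have "W.\<xi> = \<xi>" using assms(10) by (auto simp: W.\<xi>_def)
  ultimately show ?thesis
    using W.steady_gradient_ricci_soliton_M[OF assms(4) smooth_h ode] by simp
qed

end
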